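(* Let $\epsilon>0$, let $s$ be a positive integer, and let $g:\mathbb{N}\to(0,1)$ be a decreasing function. Let $\delta(t)=\min\big(\frac{g(t)^3}{32t^2},\epsilon/2\big)$. Let $t_1=s$ and for $i\ge1$ let $t_{i+1}=t_i\,k(\delta(t_i))$. Let $T_0=t_j$ with $j=4\epsilon^{-2}$ and $T=16T_0/\delta(T_0)^2$. Then for every graph $G$ on $n$ vertices one can add to or remove from $G$ at most $\epsilon n^2$ edges and thus obtain a graph $G'$ that has a $g$-regular equitable vertex partition into $k$ parts for some $s\le k\le T$.
   Context: For vertex subsets $X,Y$, $e(X,Y)$ is the number of pairs in $X\times Y$ that are edges and $d(X,Y)=e(X,Y)/(|X||Y|)$. A partition $V=V_1\cup\dots\cup V_k$ is weak $\alpha$-regular if for all $A,B\subset V$, $|e(A,B)-\sum_{i,j}d(V_i,V_j)|A\cap V_i||B\cap V_j||\le\alpha|V|^2$. Here $k(\alpha)$ denotes the bound in the Frieze–Kannan weak regularity lemma: every graph has an equitable weak $\alpha$-regular vertex partition into at most $k(\alpha)$ parts (one may take $k(\alpha)=2^{O(\alpha^{-2})}$). A pair $(A,B)$ is $\gamma$-regular if for all $A'\subset A$, $B'\subset B$ with $|A'|\ge\gamma|A|$, $|B'|\ge\gamma|B|$, $|d(A',B')-d(A,B)|\le\gamma$. An equitable partition (part sizes differ by at most 1) into $k$ parts is $g$-regular if all pairs of distinct parts are $g(k)$-regular. *)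

theory Defs
  imports Complex_Main "HOL-Library.Disjoint_Sets"
begin

definition fin_graph :: "'a set \<Rightarrow> 'a set set \<Rightarrow> bool" where
  "fin_graph V E \<longleftrightarrow> finite V \<and> (\<forall>e\<in>E. \<exists>u\<in>V. \<exists>v\<in>V. u \<noteq> v \<and> e = {u, v})"

text \<open>Ordered pairs are counted, so an edge with both ends in \<open>X \<inter> Y\<close> contributes twice.\<close>

definition edges_between :: "'a set set \<Rightarrow> 'a set \<Rightarrow> 'a set \<Rightarrow> nat" where
  "edges_between E X Y = card {(x, y) \<in> X \<times> Y. {x, y} \<in> E}"

text \<open>The density is \<open>0\<close> if one of the sets is empty.\<close>

definition density :: "'a set set \<Rightarrow> 'a set \<Rightarrow> 'a set \<Rightarrow> real" where
  "density E X Y = real (edges_between E X Y) / (real (card X) * real (card Y))"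

text \<open>
  The parts are \<open>P 0, \<dots>, P (m - 1)\<close> and may be empty. In an equitable partition this
  happens only if \<open>m > card V\<close>, and then every part has at most one vertex.
\<close>

definition equitable_partition :: "'a set \<Rightarrow> nat \<Rightarrow> (nat \<Rightarrow> 'a set) \<Rightarrow> bool" where
  "equitable_partition V m P \<longleftrightarrow>
     disjoint_family_on P {..<m} \<and> (\<Union>i<m. P i) = V \<and>
     (\<forall>i<m. \<forall>j<m. card (P i) \<le> card (P j) + 1)"

definition weak_regular ::
    "real \<Rightarrow> 'a set \<Rightarrow> 'a set set \<Rightarrow> nat \<Rightarrow> (nat \<Rightarrow> 'a set) \<Rightarrow> bool" where
  "weak_regular \<alpha> V E m P \<longleftrightarrow>
     (\<forall>A B. A \<subseteq> V \<longrightarrow> B \<subseteq> V \<longrightarrow>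
        \<bar>real (edges_between E A B)
          - (\<Sum>i<m. \<Sum>j<m. density E (P i) (P j) * real (card (A \<inter> P i)) * real (card (B \<inter> P j)))\<bar>
        \<le> \<alpha> * (real (card V))\<^sup>2)"

text \<open>
  \<open>k\<close> is a valid bound function in the Frieze--Kannan weak regularity lemma. Every finite graph
  is isomorphic to one on natural numbers, so quantifying over those loses nothing.
\<close>

definition weak_regularity_bound :: "(real \<Rightarrow> nat) \<Rightarrow> bool" where
  "weak_regularity_bound k \<longleftrightarrow>
     (\<forall>\<alpha>>0. \<forall>(V :: nat set) E. fin_graph V E \<longrightarrow>
        (\<exists>m P. m \<le> k \<alpha> \<and> equitable_partition V m P \<and> weak_regular \<alpha> V E m P))"

definition regular_pair :: "real \<Rightarrow> 'a set set \<Rightarrow> 'a set \<Rightarrow> 'a set \<Rightarrow> bool" where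
  "regular_pair \<gamma> E A B \<longleftrightarrow>
     (\<forall>A' B'. A' \<subseteq> A \<longrightarrow> B' \<subseteq> B \<longrightarrow>
        real (card A') \<ge> \<gamma> * real (card A) \<longrightarrow> real (card B') \<ge> \<gamma> * real (card B) \<longrightarrow>
        \<bar>density E A' B' - density E A B\<bar> \<le> \<gamma>)"

definition g_regular_partition ::
    "(nat \<Rightarrow> real) \<Rightarrow> 'a set set \<Rightarrow> nat \<Rightarrow> (nat \<Rightarrow> 'a set) \<Rightarrow> bool" where
  "g_regular_partition g E m P \<longleftrightarrow>
     (\<forall>i<m. \<forall>j<m. i \<noteq> j \<longrightarrow> regular_pair (g m) E (P i) (P j))"

end

theory Submission
  imports Defs "HOL-Analysis.Convex"
begin

text \<open>
  Write \<open>G\<close> for the adjacency function of the graph, \<open>G\<^sub>P\<close> for its block averages over a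
  partition \<open>P\<close>, and let \<open>P\<close> have \<open>m\<close> parts. Energy increments refine \<open>P\<close> to some \<open>R\<close> such that
  \<open>G - G\<^sub>R\<close> has small cut norm even after multiplication by a weight \<open>\<theta>\<close> that depends on \<open>G\<^sub>R\<close> and
  \<open>G\<^sub>P\<close>; a plain weakly regular \<open>R\<close> would not control that product. If \<open>G\<^sub>R\<close> is
  \<open>\<ell>\<^sub>2\<close>-close to \<open>G\<^sub>P\<close>, then for the right \<open>\<theta>\<close> the function \<open>G\<^sub>P + \<theta> (G - G\<^sub>R)\<close> has values in
  \<open>[0, 1]\<close>, is \<open>\<ell>\<^sub>1\<close>-close to \<open>G\<close> and is nearly constant on the blocks of \<open>P\<close> in cut norm, and
  rounding it at random gives the required graph. Otherwise an equitable partition close to \<open>R\<close>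
  explains substantially more of the energy of \<open>G\<close> and replaces \<open>P\<close>.

  The passage from \<open>P\<close> to \<open>R\<close> multiplies the number of parts by \<open>2\<close> to the power \<open>O(\<delta>(m)\<^sup>-\<^sup>2)\<close>. That
  this fits into the sequence \<open>t\<close> follows from a lower bound: every valid \<open>k\<close> satisfies
  \<open>k(\<alpha>) \<ge> 2\<^sup>e\<close> when \<open>\<alpha> \<le> 1 / (512 e)\<close>, because few parts cannot resolve the points of a
  high-dimensional cube. The existence of weakly regular partitions into \<open>k(\<alpha>)\<close> parts is used
  only through this bound.
\<close>

subsection \<open>Conditional averages\<close>

text \<open>Conditional expectation under the uniform measure on \<open>S\<close>, given the key
  \<open>\<kappa>\<close>. An empty fibre yields \<open>0 / 0 = 0\<close>, so the bounds below hold
  for every \<open>x\<close>, in \<open>S\<close> or not.\<close>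

definition cavg :: "'b set \<Rightarrow> ('b \<Rightarrow> 'k) \<Rightarrow> ('b \<Rightarrow> real) \<Rightarrow> 'b \<Rightarrow> real" where
  "cavg S \<kappa> F x = (\<Sum>y\<in>{y\<in>S. \<kappa> y = \<kappa> x}. F y) / real (card {y\<in>S. \<kappa> y = \<kappa> x})"

lemma cavg_cong_key: "\<kappa> x = \<kappa> y \<Longrightarrow> cavg S \<kappa> F x = cavg S \<kappa> F y"
  by (simp add: cavg_def)

text \<open>Averaging is the orthogonal projection onto the functions that are constant on the
  fibres of \<open>\<kappa>\<close>: on each fibre \<open>W\<close> comes out of the sum.\<close>

lemma sum_mult_cavg:
  assumes S: "finite S"
    and W: "\<And>x y. x \<in> S \<Longrightarrow> y \<in> S \<Longrightarrow> \<kappa> x = \<kappa> y \<Longrightarrow> W x = W y"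
  shows "(\<Sum>x\<in>S. W x * cavg S \<kappa> F x) = (\<Sum>x\<in>S. W x * F x)"
proof -
  have fib: "(\<Sum>x\<in>{x\<in>S. \<kappa> x = c}. W x * cavg S \<kappa> F x) = (\<Sum>x\<in>{x\<in>S. \<kappa> x = c}. W x * F x)"
    if c: "c \<in> \<kappa> ` S" for c
  proof -
    obtain z where z: "z \<in> S" "\<kappa> z = c" using c by auto
    let ?C = "{x\<in>S. \<kappa> x = c}"
    have card: "card ?C \<noteq> 0" using z S by auto
    have "(\<Sum>x\<in>?C. W x * cavg S \<kappa> F x) = (\<Sum>x\<in>?C. W z * (sum F ?C / real (card ?C)))"
      using z by (intro sum.cong) (auto simp: cavg_def intro: W)
    also have "\<dots> = W z * sum F ?C" using card by simp
    also have "\<dots> = (\<Sum>x\<in>?C. W x * F x)"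
      unfolding sum_distrib_left using z by (intro sum.cong) (auto intro: W)
    finally show ?thesis .
  qed
  have "(\<Sum>x\<in>S. W x * cavg S \<kappa> F x) = (\<Sum>c\<in>\<kappa> ` S. \<Sum>x\<in>{x\<in>S. \<kappa> x = c}. W x * cavg S \<kappa> F x)"
    using S by (intro sum.group[symmetric]) auto
  also have "\<dots> = (\<Sum>c\<in>\<kappa> ` S. \<Sum>x\<in>{x\<in>S. \<kappa> x = c}. W x * F x)"
    by (intro sum.cong fib refl)
  also have "\<dots> = (\<Sum>x\<in>S. W x * F x)" using S by (intro sum.group) auto
  finally show ?thesis .
qed

lemma cavg_bounds:
  assumes S: "finite S" and F: "\<And>x. x \<in> S \<Longrightarrow> F x \<in> {0..1}"
  shows "cavg S \<kappa> F x \<in> {0..1}"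
proof -
  let ?C = "{y\<in>S. \<kappa> y = \<kappa> x}"
  have "0 \<le> sum F ?C" using F by (intro sum_nonneg) auto
  moreover have "sum F ?C \<le> real (card ?C) * 1"
    using F by (intro sum_bounded_above) auto
  ultimately show ?thesis unfolding cavg_def by (auto simp: divide_le_eq_1)
qed

text \<open>The residual \<open>F - cavg S \<kappa> F\<close> is orthogonal to the fibrewise
  constant function \<open>cavg S \<kappa> F - W\<close>, so the mixed term vanishes.\<close>

lemma cavg_pythagoras:
  assumes S: "finite S"
    and W: "\<And>x y. x \<in> S \<Longrightarrow> y \<in> S \<Longrightarrow> \<kappa> x = \<kappa> y \<Longrightarrow> W x = W y"
  shows "(\<Sum>x\<in>S. (F x - W x)\<^sup>2) =
    (\<Sum>x\<in>S. (F x - cavg S \<kappa> F x)\<^sup>2) + (\<Sum>x\<in>S. (cavg S \<kappa> F x - W x)\<^sup>2)"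
proof -
  let ?c = "cavg S \<kappa> F"
  have "(\<Sum>x\<in>S. (?c x - W x) * ?c x) = (\<Sum>x\<in>S. (?c x - W x) * F x)"
    by (intro sum_mult_cavg[OF S] arg_cong2[where f = "(-)"] cavg_cong_key W)
  hence "(\<Sum>x\<in>S. (F x - ?c x) * (?c x - W x)) = 0"
    by (simp add: algebra_simps sum_subtractf sum.distrib)
  moreover have "(\<Sum>x\<in>S. (F x - W x)\<^sup>2) = (\<Sum>x\<in>S. (F x - ?c x)\<^sup>2 + (?c x - W x)\<^sup>2
      + 2 * ((F x - ?c x) * (?c x - W x)))"
    by (intro sum.cong refl) (simp add: power2_eq_square algebra_simps)
  ultimately show ?thesis by (simp add: sum.distrib sum_distrib_left[symmetric])
qed

subsection \<open>Derandomised rounding\<close>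

lemma exp_le_quadratic:
  fixes y :: real
  assumes "\<bar>y\<bar> \<le> 1"
  shows "exp y \<le> 1 + y + y\<^sup>2"
proof (cases "y \<ge> 0")
  case True
  thus ?thesis using exp_bound[of y] assms by simp
next
  case False
  define z where "z = - y"
  have z: "0 \<le> z" "z \<le> 1" using False assms by (auto simp: z_def)
  \<comment> \<open>The product is \<open>1 + z ^ 3\<close>.\<close>
  have "1 \<le> (1 - z + z\<^sup>2) * (1 + z)"
    using z by (simp add: power2_eq_square algebra_simps)
  also have "\<dots> \<le> (1 - z + z\<^sup>2) * exp z"
    using z exp_ge_add_one_self[of z] sum_power2_ge_zero[of z 1]
    by (intro mult_left_mono) (auto simp: add.commute)
  finally have "exp (- z) \<le> 1 - z + z\<^sup>2" by (simp add: exp_minus field_simps)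
  thus ?thesis by (simp add: z_def)
qed

text \<open>Moment generating function of a centred Bernoulli variable: the linear terms cancel and
  the variance \<open>p * (1 - p)\<close> is at most \<open>1/4\<close>.\<close>

lemma exp_bernoulli_le:
  fixes p y :: real
  assumes p: "0 \<le> p" "p \<le> 1" and y: "\<bar>y\<bar> \<le> 1"
  shows "p * exp (y * (1 - p)) + (1 - p) * exp (y * (0 - p)) \<le> exp (y\<^sup>2 / 4)"
proof -
  have a: "\<bar>y * (1 - p)\<bar> \<le> 1" "\<bar>y * (0 - p)\<bar> \<le> 1"
    using p y by (auto simp: abs_mult intro: mult_le_one)
  have "p * exp (y * (1 - p)) + (1 - p) * exp (y * (0 - p)) \<le>
     p * (1 + y * (1 - p) + (y * (1 - p))\<^sup>2) + (1 - p) * (1 + y * (0 - p) + (y * (0 - p))\<^sup>2)"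
    using p a by (intro add_mono mult_left_mono exp_le_quadratic) auto
  also have "\<dots> = 1 + y\<^sup>2 * (p * (1 - p))" by (simp add: power2_eq_square algebra_simps)
  also have "\<dots> \<le> 1 + y\<^sup>2 * (1 / 4)"
  proof -
    have "0 \<le> (p - 1/2)\<^sup>2" by simp
    hence "p * (1 - p) \<le> 1 / 4" by (simp add: power2_eq_square field_simps)
    thus ?thesis by (intro add_left_mono mult_left_mono) auto
  qed
  also have "\<dots> \<le> exp (y\<^sup>2 / 4)" using exp_ge_add_one_self[of "y\<^sup>2/4"] by simp
  finally show ?thesis .
qed

lemma convex_combination_le:
  fixes a b c p :: real
  assumes p: "0 \<le> p" "p \<le> 1" and le: "p * a + (1 - p) * b \<le> c"
  shows "a \<le> c \<or> b \<le> c"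
proof (rule ccontr)
  assume "\<not> ?thesis"
  hence ab: "c < a" "c < b" by auto
  have "p * c + (1 - p) * c < p * a + (1 - p) * b"
  proof (cases "p = 0")
    case False
    thus ?thesis using p ab by (intro add_less_le_mono mult_strict_left_mono mult_left_mono) auto
  qed (use ab in simp)
  with le show False by (simp add: algebra_simps)
qed

text \<open>Method of conditional expectations. Putting \<open>a\<close> into the set with
  probability \<open>p a\<close> multiplies the expected potential by at most
  \<open>exp (l\<^sup>2 / 4)\<close>, hence one of the two choices does no worse. Both signs of the
  exponent are carried to control deviations from above and from below.\<close>

lemma rounding_potential:
  fixes c :: "'c \<Rightarrow> 'e \<Rightarrow> real" and p :: "'e \<Rightarrow> real" and l :: real
  assumes I: "finite I" and p: "\<And>e. e \<in> I \<Longrightarrow> p e \<in> {0..1}"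
    and c: "\<And>j e. j \<in> J \<Longrightarrow> e \<in> I \<Longrightarrow> \<bar>c j e\<bar> \<le> 1" and l: "\<bar>l\<bar> \<le> 1"
  shows "\<exists>X\<subseteq>I. (\<Sum>j\<in>J. exp (l * (\<Sum>e\<in>I. c j e * (of_bool (e \<in> X) - p e)))
           + exp (- l * (\<Sum>e\<in>I. c j e * (of_bool (e \<in> X) - p e))))
         \<le> 2 * real (card J) * exp (l\<^sup>2 / 4) ^ card I"
  using I p c
proof (induction I)
  case empty
  thus ?case by simp
next
  case (insert a I)
  let ?S = "\<lambda>I X j. \<Sum>e\<in>I. c j e * (of_bool (e \<in> X) - p e)"
  let ?\<Phi> = "\<lambda>I X. \<Sum>j\<in>J. exp (l * ?S I X j) + exp (- l * ?S I X j)"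
  from insert obtain X where X: "X \<subseteq> I"
    "?\<Phi> I X \<le> 2 * real (card J) * exp (l\<^sup>2 / 4) ^ card I" by auto
  have aX: "a \<notin> X" using X insert by auto
  have pa: "0 \<le> p a" "p a \<le> 1" using insert.prems by auto
  have S0: "?S (insert a I) X j = c j a * (0 - p a) + ?S I X j" for j
    using insert aX by simp
  have S1: "?S (insert a I) (insert a X) j = c j a * (1 - p a) + ?S I X j" for j
  proof -
    have "?S I (insert a X) j = ?S I X j" using insert.hyps by (intro sum.cong) auto
    thus ?thesis using insert.hyps by simp
  qed
  have avg: "p a * exp (u * ?S (insert a I) (insert a X) j)
      + (1 - p a) * exp (u * ?S (insert a I) X j) \<le> exp (l\<^sup>2 / 4) * exp (u * ?S I X j)"
    if u: "\<bar>u\<bar> \<le> 1" "u\<^sup>2 = l\<^sup>2" and j: "j \<in> J" for u j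
  proof -
    have cj: "\<bar>c j a\<bar> \<le> 1" using insert.prems j by auto
    have ab: "\<bar>u * c j a\<bar> \<le> 1" using u cj by (simp add: abs_mult mult_le_one)
    have "(u * c j a)\<^sup>2 \<le> l\<^sup>2 * 1"
      unfolding power_mult_distrib u(2) using cj
      by (intro mult_left_mono) (auto simp: abs_square_le_1)
    hence e: "exp ((u * c j a)\<^sup>2 / 4) \<le> exp (l\<^sup>2 / 4)" by simp
    have "p a * exp (u * ?S (insert a I) (insert a X) j) + (1 - p a) * exp (u * ?S (insert a I) X j)
      = (p a * exp (u * c j a * (1 - p a)) + (1 - p a) * exp (u * c j a * (0 - p a))) * exp (u * ?S I X j)"
      unfolding S0 S1 by (simp only: distrib_left distrib_right exp_add mult.assoc)
    also have "\<dots> \<le> exp (l\<^sup>2 / 4) * exp (u * ?S I X j)"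
      by (intro mult_right_mono order_trans[OF exp_bernoulli_le[OF pa ab] e]) auto
    finally show ?thesis .
  qed
  have alg: "r * (u + v) + q * (u' + v') = (r * u + q * u') + (r * v + q * v')"
    for r q u v u' v' :: real
    by (simp add: algebra_simps)
  have "p a * ?\<Phi> (insert a I) (insert a X) + (1 - p a) * ?\<Phi> (insert a I) X
     = (\<Sum>j\<in>J. (p a * exp (l * ?S (insert a I) (insert a X) j)
      + (1 - p a) * exp (l * ?S (insert a I) X j)) +
       (p a * exp (- l * ?S (insert a I) (insert a X) j)
      + (1 - p a) * exp (- l * ?S (insert a I) X j)))"
    unfolding sum_distrib_left sum.distrib[symmetric]
    by (intro sum.cong refl alg)
  also have "\<dots> \<le> (\<Sum>j\<in>J. exp (l\<^sup>2 / 4) * exp (l * ?S I X j) + exp (l\<^sup>2 / 4) * exp (- l * ?S I X j))"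
    using l by (intro sum_mono add_mono avg) auto
  also have "\<dots> = exp (l\<^sup>2 / 4) * ?\<Phi> I X" by (simp only: sum_distrib_left distrib_left)
  finally have le: "p a * ?\<Phi> (insert a I) (insert a X) + (1 - p a) * ?\<Phi> (insert a I) X
     \<le> exp (l\<^sup>2 / 4) * ?\<Phi> I X" .
  have X': "insert a X \<subseteq> insert a I" "X \<subseteq> insert a I" using X(1) by auto
  obtain Y where Y: "Y \<subseteq> insert a I" "?\<Phi> (insert a I) Y \<le> exp (l\<^sup>2 / 4) * ?\<Phi> I X"
    using convex_combination_le[OF pa le] X' by (elim disjE) (rule that, assumption+)+
  note Y(2)
  also have "exp (l\<^sup>2 / 4) * ?\<Phi> I X \<le> exp (l\<^sup>2 / 4) * (2 * real (card J) * exp (l\<^sup>2 / 4) ^ card I)"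
    using X by (intro mult_left_mono) auto
  also have "\<dots> = 2 * real (card J) * exp (l\<^sup>2 / 4) ^ card (insert a I)"
    using insert.hyps by simp
  finally have "?\<Phi> (insert a I) Y \<le> 2 * real (card J) * exp (l\<^sup>2 / 4) ^ card (insert a I)" .
  with Y(1) show ?case by (intro exI conjI)
qed

text \<open>One exponential is at most the whole potential; logarithms then bound every test at
  once. The number of tests enters only through its logarithm, which permits exponentially many of
  them.\<close>

lemma rounding:
  fixes c :: "'c \<Rightarrow> 'e \<Rightarrow> real" and p :: "'e \<Rightarrow> real" and l :: real
  assumes I: "finite I" and J: "finite J" and p: "\<And>e. e \<in> I \<Longrightarrow> p e \<in> {0..1}"
    and c: "\<And>j e. j \<in> J \<Longrightarrow> e \<in> I \<Longrightarrow> \<bar>c j e\<bar> \<le> 1" and l: "0 < l" "l \<le> 1"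
  obtains X where "X \<subseteq> I" and "\<And>j. j \<in> J \<Longrightarrow>
    \<bar>\<Sum>e\<in>I. c j e * (of_bool (e \<in> X) - p e)\<bar> \<le> ln (2 * real (card J)) / l + l * real (card I) / 4"
proof -
  have "\<exists>X\<subseteq>I. (\<Sum>j\<in>J. exp (l * (\<Sum>e\<in>I. c j e * (of_bool (e \<in> X) - p e)))
           + exp (- l * (\<Sum>e\<in>I. c j e * (of_bool (e \<in> X) - p e))))
         \<le> 2 * real (card J) * exp (l\<^sup>2 / 4) ^ card I"
    by (rule rounding_potential) (use I p c l in auto)
  then obtain X where X: "X \<subseteq> I" and
    le: "(\<Sum>j\<in>J. exp (l * (\<Sum>e\<in>I. c j e * (of_bool (e \<in> X) - p e)))
           + exp (- l * (\<Sum>e\<in>I. c j e * (of_bool (e \<in> X) - p e))))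
         \<le> 2 * real (card J) * exp (l\<^sup>2 / 4) ^ card I"
    by (elim exE conjE) (rule that)
  show ?thesis
  proof (rule that[OF X])
    fix j assume j: "j \<in> J"
    let ?s = "\<Sum>e\<in>I. c j e * (of_bool (e \<in> X) - p e)"
    have J0: "card J > 0" using j J card_gt_0_iff by blast
    have "exp (l * \<bar>?s\<bar>) \<le> exp (l * ?s) + exp (- l * ?s)"
      by (cases "?s \<ge> 0") auto
    also have "\<dots> \<le> (\<Sum>j\<in>J. exp (l * (\<Sum>e\<in>I. c j e * (of_bool (e \<in> X) - p e)))
           + exp (- l * (\<Sum>e\<in>I. c j e * (of_bool (e \<in> X) - p e))))"
      using j J by (intro member_le_sum[of j J]) (auto intro: add_nonneg_nonneg)
    also note le
    also have "2 * real (card J) * exp (l\<^sup>2 / 4) ^ card I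
      = exp (ln (2 * real (card J)) + real (card I) * (l\<^sup>2 / 4))"
      using J0 by (simp add: exp_add exp_of_nat_mult[symmetric])
    finally have "l * \<bar>?s\<bar> \<le> ln (2 * real (card J)) + real (card I) * (l\<^sup>2 / 4)" by simp
    thus "\<bar>?s\<bar> \<le> ln (2 * real (card J)) / l + l * real (card I) / 4"
      using l by (simp add: field_simps power2_eq_square)
  qed
qed

subsection \<open>Calibrated refinements\<close>

text \<open>
  The largest weight for which \<open>p + theta q p * (y - q)\<close> stays in \<open>[0, 1]\<close> for \<open>y = 0\<close> and \<open>y = 1\<close>.
  For \<open>q = 0\<close> the division by zero only occurs if \<open>p = 0\<close>, where the value \<open>0\<close> is harmless.
\<close>

definition theta :: "real \<Rightarrow> real \<Rightarrow> real" where
  "theta q p = (if p \<le> q then p / q else (1 - p) / (1 - q))"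

lemma theta_bounds:
  assumes "q \<in> {0..1}" "p \<in> {0..1}"
  shows "theta q p \<in> {0..1}"
  using assms by (auto simp: theta_def divide_le_eq_1)

lemma theta_shift_bounds:
  assumes "q \<in> {0..1}" "p \<in> {0..1}" "y \<in> {0..1}"
  shows "p + theta q p * (y - q) \<in> {0..1}"
proof (cases "p \<le> q")
  case True
  hence "p + theta q p * (y - q) = y * theta q p"
    using assms by (cases "q = 0") (auto simp: theta_def field_simps)
  moreover have "y * theta q p \<in> {0..1}"
    using theta_bounds[OF assms(1,2)] assms by (auto intro: mult_le_one)
  ultimately show ?thesis by simp
next
  case False
  hence "p + theta q p * (y - q) = 1 - (1 - y) * theta q p"
    using assms by (auto simp: theta_def divide_simps) (auto simp: algebra_simps)
  moreover have "(1 - y) * theta q p \<in> {0..1}"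
    using theta_bounds[OF assms(1,2)] assms by (auto intro: mult_le_one)
  ultimately show ?thesis by simp
qed

text \<open>The shifted value lies below \<open>y\<close> if \<open>p \<le> q\<close> and above it
  otherwise, so the absolute value resolves. The excess over \<open>\<bar>p - q\<bar>\<close> is a
  multiple of \<open>y - q\<close> whose coefficient depends on \<open>p\<close> and
  \<open>q\<close> only; it sums to zero once \<open>q\<close> is a block average of
  \<open>y\<close> and \<open>p\<close> is constant on the blocks.\<close>

lemma theta_shift_dist:
  assumes "q \<in> {0..1}" "p \<in> {0..1}" "y \<in> {0..1}"
  shows "\<bar>p + theta q p * (y - q) - y\<bar>
    = \<bar>p - q\<bar> + (if p \<le> q then 1 else -1) * (1 - theta q p) * (y - q)"
proof (cases "p \<le> q")
  case True
  have e: "theta q p * q = p" using True assms by (auto simp: theta_def)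
  have "p + theta q p * (y - q) - y = - (y * (1 - theta q p))"
    using e by (simp add: algebra_simps)
  moreover have "0 \<le> y * (1 - theta q p)" using theta_bounds[OF assms(1,2)] assms by auto
  ultimately have "\<bar>p + theta q p * (y - q) - y\<bar> = y * (1 - theta q p)" by simp
  thus ?thesis using True e by (simp add: algebra_simps)
next
  case False
  have e: "theta q p * (1 - q) = 1 - p" using False assms by (auto simp: theta_def)
  have "p + theta q p * (y - q) - y = (1 - y) * (1 - theta q p)"
    using e by (simp add: algebra_simps)
  moreover have "0 \<le> (1 - y) * (1 - theta q p)" using theta_bounds[OF assms(1,2)] assms by auto
  ultimately have "\<bar>p + theta q p * (y - q) - y\<bar> = (1 - y) * (1 - theta q p)" by simp
  thus ?thesis using False e by (simp add: algebra_simps)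
qed

section \<open>Block averages over vertex colourings and the unexplained energy\<close>

definition bavg :: "'a set \<Rightarrow> ('a \<Rightarrow> nat) \<Rightarrow> ('a \<times> 'a \<Rightarrow> real) \<Rightarrow> 'a \<times> 'a \<Rightarrow> real" where
  "bavg V \<pi> F = cavg (V \<times> V) (map_prod \<pi> \<pi>) F"

text \<open>The energy of \<open>F\<close> that the blocks of \<open>\<pi>\<close> leave
  unexplained, without normalisation by \<open>(card V)\<^sup>2\<close>. An energy increment is a
  decrease of this quantity.\<close>

definition bvar :: "'a set \<Rightarrow> ('a \<Rightarrow> nat) \<Rightarrow> ('a \<times> 'a \<Rightarrow> real) \<Rightarrow> real" where
  "bvar V \<pi> F = (\<Sum>z\<in>V \<times> V. (F z - bavg V \<pi> F z)\<^sup>2)"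

definition colour_refines :: "'a set \<Rightarrow> ('a \<Rightarrow> nat) \<Rightarrow> ('a \<Rightarrow> nat) \<Rightarrow> bool" where
  "colour_refines V \<rho> \<pi> \<longleftrightarrow> (\<forall>x\<in>V. \<forall>y\<in>V. \<rho> x = \<rho> y \<longrightarrow> \<pi> x = \<pi> y)"

lemma colour_refines_refl: "colour_refines V \<pi> \<pi>"
  by (simp add: colour_refines_def)

lemma colour_refinesD: "colour_refines V \<rho> \<pi> \<Longrightarrow> x \<in> V \<Longrightarrow> y \<in> V \<Longrightarrow> \<rho> x = \<rho> y \<Longrightarrow> \<pi> x = \<pi> y"
  unfolding colour_refines_def by blast

lemma colour_refines_trans:
  "colour_refines V \<sigma> \<rho> \<Longrightarrow> colour_refines V \<rho> \<pi> \<Longrightarrow> colour_refines V \<sigma> \<pi>"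
  unfolding colour_refines_def by blast

lemma bavg_cong_refines:
  assumes "colour_refines V \<rho> \<pi>" "z \<in> V \<times> V" "w \<in> V \<times> V" "map_prod \<rho> \<rho> z = map_prod \<rho> \<rho> w"
  shows "bavg V \<pi> F z = bavg V \<pi> F w"
  unfolding bavg_def
  by (rule cavg_cong_key)
    (use assms(2-) in \<open>auto intro: colour_refinesD[OF assms(1)]\<close>)

lemma bavg_bounds:
  assumes "finite V" "\<And>z. z \<in> V \<times> V \<Longrightarrow> F z \<in> {0..1}"
  shows "bavg V \<pi> F z \<in> {0..1}"
  unfolding bavg_def by (rule cavg_bounds) (use assms(1) in simp, rule assms(2))

lemma bvar_nonneg: "0 \<le> bvar V \<pi> F"
  unfolding bvar_def by (intro sum_nonneg) auto

lemma bvar_pythagoras: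
  assumes "finite V"
    and "\<And>z w. z \<in> V \<times> V \<Longrightarrow> w \<in> V \<times> V \<Longrightarrow> map_prod \<pi> \<pi> z = map_prod \<pi> \<pi> w \<Longrightarrow> W z = W w"
  shows "(\<Sum>z\<in>V \<times> V. (F z - W z)\<^sup>2) = bvar V \<pi> F + (\<Sum>z\<in>V \<times> V. (bavg V \<pi> F z - W z)\<^sup>2)"
  unfolding bvar_def bavg_def
  by (rule cavg_pythagoras[OF _ assms(2)]) (use assms(1) in simp_all)

lemma bvar_le:
  assumes "finite V"
    and "\<And>z w. z \<in> V \<times> V \<Longrightarrow> w \<in> V \<times> V \<Longrightarrow> map_prod \<pi> \<pi> z = map_prod \<pi> \<pi> w \<Longrightarrow> W z = W w"
  shows "bvar V \<pi> F \<le> (\<Sum>z\<in>V \<times> V. (F z - W z)\<^sup>2)"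
proof -
  have "(\<Sum>z\<in>V \<times> V. (F z - W z)\<^sup>2) = bvar V \<pi> F + (\<Sum>z\<in>V \<times> V. (bavg V \<pi> F z - W z)\<^sup>2)"
    by (rule bvar_pythagoras[OF assms])
  thus ?thesis by (simp add: sum_nonneg)
qed

text \<open>Comparison with the constant \<open>1/2\<close> instead of \<open>0\<close> gains the
  factor 4 in the later limits \<open>1 / (4 * \<beta>\<^sup>2)\<close> and
  \<open>1 / (4 * \<epsilon>\<^sup>2)\<close> on the numbers of rounds.\<close>

lemma bvar_le_quarter:
  assumes V: "finite V" and F: "\<And>z. z \<in> V \<times> V \<Longrightarrow> F z \<in> {0..1}"
  shows "bvar V \<pi> F \<le> (real (card V))\<^sup>2 / 4"
proof -
  have "bvar V \<pi> F \<le> (\<Sum>z\<in>V \<times> V. (F z - 1/2)\<^sup>2)"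
    by (rule bvar_le[OF V]) simp
  also have "\<dots> \<le> real (card (V \<times> V)) * (1/4)"
  proof (intro sum_bounded_above)
    fix z assume "z \<in> V \<times> V"
    hence "F z * (1 - F z) \<ge> 0" using F[of z] by auto
    thus "(F z - 1/2)\<^sup>2 \<le> 1/4" by (simp add: power2_eq_square algebra_simps)
  qed
  finally show ?thesis by (simp add: card_cartesian_product power2_eq_square)
qed

lemma bvar_diff_refines:
  assumes "finite V" "colour_refines V \<rho> \<pi>"
  shows "(\<Sum>z\<in>V \<times> V. (bavg V \<rho> F z - bavg V \<pi> F z)\<^sup>2) = bvar V \<pi> F - bvar V \<rho> F"
proof -
  have "bvar V \<pi> F = bvar V \<rho> F + (\<Sum>z\<in>V \<times> V. (bavg V \<rho> F z - bavg V \<pi> F z)\<^sup>2)"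
    unfolding bvar_def[of V \<pi>]
    by (rule bvar_pythagoras[where W = "bavg V \<pi> F", OF assms(1)]) (rule bavg_cong_refines[OF assms(2)])
  thus ?thesis by simp
qed

text \<open>Every class is split by membership in \<open>A\<close> and in \<open>B\<close>. The
  weight restricted to \<open>A \<times> B\<close> is then constant on the new blocks, so it
  correlates with \<open>F - bavg V \<rho> F\<close> exactly as with
  \<open>bavg V \<sigma> F - bavg V \<rho> F\<close>, and Cauchy-Schwarz turns the correlation into
  an energy drop.\<close>

lemma bvar_decrement:
  fixes V :: "'a set" and F :: "'a \<times> 'a \<Rightarrow> real"
  assumes V: "finite V" and F: "\<And>z. z \<in> V \<times> V \<Longrightarrow> F z \<in> {0..1}"
    and ref: "colour_refines V \<rho> \<pi>" and \<rho>: "\<rho> ` V \<subseteq> {..<K}" and \<beta>: "\<beta> > 0"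
    and AB: "A \<subseteq> V" "B \<subseteq> V"
    and large: "\<bar>\<Sum>z\<in>A \<times> B. theta (bavg V \<rho> F z) (bavg V \<pi> F z) * (F z - bavg V \<rho> F z)\<bar>
      > \<beta> * (real (card V))\<^sup>2"
  obtains \<sigma> where "colour_refines V \<sigma> \<rho>" "\<sigma> ` V \<subseteq> {..<4 * K}"
    "bvar V \<sigma> F < bvar V \<rho> F - \<beta>\<^sup>2 * (real (card V))\<^sup>2"
proof -
  \<comment> \<open>Membership in \<open>A\<close> and \<open>B\<close> as a base-4 digit appended
    to \<open>\<rho>\<close>, recovered by \<open>div\<close> and \<open>mod\<close>.\<close>
  define h where "h x = (if x \<in> A then if x \<in> B then 3 else 2 else if x \<in> B then 1 else 0 :: nat)" for x
  define \<sigma> where "\<sigma> x = 4 * \<rho> x + h x" for x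
  have h4: "h x < 4" for x by (simp add: h_def)
  have dec: "\<rho> x = \<rho> y \<and> (x \<in> A \<longleftrightarrow> y \<in> A) \<and> (x \<in> B \<longleftrightarrow> y \<in> B)" if "\<sigma> x = \<sigma> y" for x y
  proof -
    have "\<sigma> x div 4 = \<rho> x" "\<sigma> x mod 4 = h x" "\<sigma> y div 4 = \<rho> y" "\<sigma> y mod 4 = h y"
      using h4[of x] h4[of y] by (simp_all add: \<sigma>_def)
    hence "\<rho> x = \<rho> y" "h x = h y" using that by simp_all
    thus ?thesis by (simp add: h_def split: if_splits)
  qed
  have ref': "colour_refines V \<sigma> \<rho>" unfolding colour_refines_def using dec by blast
  have ran: "\<sigma> ` V \<subseteq> {..<4 * K}"
  proof
    fix a assume "a \<in> \<sigma> ` V"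
    then obtain x where x: "x \<in> V" "a = \<sigma> x" by auto
    have "\<rho> x < K" using x \<rho> by auto
    thus "a \<in> {..<4 * K}" using h4[of x] by (simp add: x \<sigma>_def)
  qed
  define W where "W z = theta (bavg V \<rho> F z) (bavg V \<pi> F z) * of_bool (z \<in> A \<times> B)" for z
  have Wmeas: "W z = W w"
    if "z \<in> V \<times> V" "w \<in> V \<times> V" "map_prod \<sigma> \<sigma> z = map_prod \<sigma> \<sigma> w" for z w
  proof -
    have "bavg V \<rho> F z = bavg V \<rho> F w" by (rule bavg_cong_refines[OF ref' that])
    moreover have "bavg V \<pi> F z = bavg V \<pi> F w"
      by (rule bavg_cong_refines[OF colour_refines_trans[OF ref' ref] that])
    moreover have "z \<in> A \<times> B \<longleftrightarrow> w \<in> A \<times> B"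
      using that dec[of "fst z" "fst w"] dec[of "snd z" "snd w"] by (auto simp: map_prod_def split_beta)
    ultimately show ?thesis by (simp add: W_def)
  qed
  have W01: "W z \<in> {0..1}" for z
    using theta_bounds[OF bavg_bounds[OF V F] bavg_bounds[OF V F]] by (auto simp: W_def)
  let ?d = "\<lambda>z. bavg V \<sigma> F z - bavg V \<rho> F z"
  let ?S = "\<Sum>z\<in>A \<times> B. theta (bavg V \<rho> F z) (bavg V \<pi> F z) * (F z - bavg V \<rho> F z)"
  have "?S = (\<Sum>z\<in>V \<times> V. W z * (F z - bavg V \<rho> F z))"
    using AB V by (intro sum.mono_neutral_cong_left) (auto simp: W_def)
  also have "\<dots> = (\<Sum>z\<in>V \<times> V. W z * F z) - (\<Sum>z\<in>V \<times> V. W z * bavg V \<rho> F z)"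
    by (simp add: algebra_simps sum_subtractf)
  also have "(\<Sum>z\<in>V \<times> V. W z * F z) = (\<Sum>z\<in>V \<times> V. W z * bavg V \<sigma> F z)"
    unfolding bavg_def 
    by (rule sum_mult_cavg[symmetric, OF _ Wmeas]) (use V in simp_all)
  also have "\<dots> - (\<Sum>z\<in>V \<times> V. W z * bavg V \<rho> F z) = (\<Sum>z\<in>V \<times> V. W z * ?d z)"
    by (simp add: algebra_simps sum_subtractf)
  finally have S: "?S = (\<Sum>z\<in>V \<times> V. W z * ?d z)" .
  have "?S\<^sup>2 \<le> (\<Sum>z\<in>V \<times> V. (W z)\<^sup>2) * (\<Sum>z\<in>V \<times> V. (?d z)\<^sup>2)"
    unfolding S by (rule Cauchy_Schwarz_ineq_sum)
  also have "\<dots> \<le> (real (card V))\<^sup>2 * (\<Sum>z\<in>V \<times> V. (?d z)\<^sup>2)"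
  proof (intro mult_right_mono)
    have "(\<Sum>z\<in>V \<times> V. (W z)\<^sup>2) \<le> real (card (V \<times> V)) * 1"
      using W01 by (intro sum_bounded_above) (auto simp: power_le_one)
    thus "(\<Sum>z\<in>V \<times> V. (W z)\<^sup>2) \<le> (real (card V))\<^sup>2"
      by (simp add: card_cartesian_product power2_eq_square)
  qed (simp add: sum_nonneg)
  also have "(\<Sum>z\<in>V \<times> V. (?d z)\<^sup>2) = bvar V \<rho> F - bvar V \<sigma> F"
    by (rule bvar_diff_refines[OF V ref'])
  finally have le: "?S\<^sup>2 \<le> (real (card V))\<^sup>2 * (bvar V \<rho> F - bvar V \<sigma> F)" .
  have "(\<beta> * (real (card V))\<^sup>2)\<^sup>2 < \<bar>?S\<bar>\<^sup>2"
    using large \<beta> by (intro power_strict_mono) auto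
  hence lt: "(real (card V))\<^sup>2 * (\<beta>\<^sup>2 * (real (card V))\<^sup>2) < (real (card V))\<^sup>2 * (bvar V \<rho> F - bvar V \<sigma> F)"
    using le by (simp add: power_mult_distrib mult_ac power2_eq_square)
  hence "\<beta>\<^sup>2 * (real (card V))\<^sup>2 < bvar V \<rho> F - bvar V \<sigma> F"
    by (rule mult_left_less_imp_less) simp
  thus ?thesis using that[OF ref' ran] by simp
qed

text \<open>While some \<open>A\<close> and \<open>B\<close> violate the bound, a split costs a
  factor 4 in colours and lowers \<open>bvar\<close> by
  \<open>\<beta>\<^sup>2 * (card V)\<^sup>2\<close>. The weight changes with the current
  \<open>\<rho>\<close>, which does no harm, since each split only uses its own violation.\<close>

lemma calibrated_refinement:
  fixes V :: "'a set" and F :: "'a \<times> 'a \<Rightarrow> real"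
  assumes V: "finite V" and F: "\<And>z. z \<in> V \<times> V \<Longrightarrow> F z \<in> {0..1}"
    and \<pi>: "\<pi> ` V \<subseteq> {..<m}" and \<beta>: "\<beta> > 0"
  obtains \<rho> r where "colour_refines V \<rho> \<pi>" "\<rho> ` V \<subseteq> {..<m * 4 ^ r}" "real r \<le> 1 / (4 * \<beta>\<^sup>2)"
    "\<And>A B. A \<subseteq> V \<Longrightarrow> B \<subseteq> V \<Longrightarrow>
      \<bar>\<Sum>z\<in>A \<times> B. theta (bavg V \<rho> F z) (bavg V \<pi> F z) * (F z - bavg V \<rho> F z)\<bar>
      \<le> \<beta> * (real (card V))\<^sup>2"
proof (rule ccontr)
  assume neg: "\<not> thesis"
  let ?n = "real (card V)"
  define dev where "dev \<rho> A B =
    \<bar>\<Sum>z\<in>A \<times> B. theta (bavg V \<rho> F z) (bavg V \<pi> F z) * (F z - bavg V \<rho> F z)\<bar>" for \<rho> A B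
  note finish = that[folded dev_def]
  have step: "\<exists>\<sigma>. colour_refines V \<sigma> \<pi> \<and> \<sigma> ` V \<subseteq> {..<m * 4 ^ Suc r}
      \<and> bvar V \<sigma> F < bvar V \<rho> F - \<beta>\<^sup>2 * ?n\<^sup>2"
    if \<rho>: "colour_refines V \<rho> \<pi>" "\<rho> ` V \<subseteq> {..<m * 4 ^ r}" and r: "real r \<le> 1 / (4 * \<beta>\<^sup>2)" for \<rho> r
  proof -
    obtain A B where AB: "A \<subseteq> V" "B \<subseteq> V"
      "dev \<rho> A B > \<beta> * ?n\<^sup>2"
    proof -
      have "\<not> (\<forall>A B. A \<subseteq> V \<longrightarrow> B \<subseteq> V \<longrightarrow> dev \<rho> A B \<le> \<beta> * ?n\<^sup>2)"
        using neg finish[OF \<rho> r] by blast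
      thus ?thesis using that by (auto simp: not_le)
    qed
    obtain \<sigma> where "colour_refines V \<sigma> \<rho>" "\<sigma> ` V \<subseteq> {..<4 * (m * 4 ^ r)}"
      "bvar V \<sigma> F < bvar V \<rho> F - \<beta>\<^sup>2 * ?n\<^sup>2"
      by (rule bvar_decrement[OF V F \<rho> \<beta> AB[unfolded dev_def]])
    thus ?thesis using colour_refines_trans[OF _ \<rho>(1)] by (intro exI[of _ \<sigma>]) (auto simp: mult_ac)
  qed
  have stage: "\<exists>\<rho>. colour_refines V \<rho> \<pi> \<and> \<rho> ` V \<subseteq> {..<m * 4 ^ r} \<and> bvar V \<rho> F \<le> ?n\<^sup>2 / 4 - real r * \<beta>\<^sup>2 * ?n\<^sup>2"
    if "real r \<le> 1 / (4 * \<beta>\<^sup>2)" for r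
    using that
  proof (induction r)
    case 0
    show ?case using \<pi> bvar_le_quarter[OF V F, where \<pi> = \<pi>] by (intro exI[of _ \<pi>]) (simp add: colour_refines_refl)
  next
    case (Suc r)
    hence r: "real r \<le> 1 / (4 * \<beta>\<^sup>2)" by simp
    from Suc.IH[OF r] obtain \<rho> where \<rho>: "colour_refines V \<rho> \<pi>" "\<rho> ` V \<subseteq> {..<m * 4 ^ r}"
      "bvar V \<rho> F \<le> ?n\<^sup>2 / 4 - real r * \<beta>\<^sup>2 * ?n\<^sup>2" by blast
    from step[OF \<rho>(1,2) r] obtain \<sigma> where \<sigma>: "colour_refines V \<sigma> \<pi>" "\<sigma> ` V \<subseteq> {..<m * 4 ^ Suc r}"
      "bvar V \<sigma> F < bvar V \<rho> F - \<beta>\<^sup>2 * ?n\<^sup>2" by blast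
    have "bvar V \<sigma> F \<le> ?n\<^sup>2 / 4 - real (Suc r) * \<beta>\<^sup>2 * ?n\<^sup>2"
      using \<sigma>(3) \<rho>(3) by (simp add: algebra_simps)
    thus ?case using \<sigma>(1,2) by blast
  qed
  \<comment> \<open>The last admissible step count; the step after it would make \<open>bvar\<close>
    negative.\<close>
  define r where "r = nat \<lfloor>1 / (4 * \<beta>\<^sup>2)\<rfloor>"
  have r: "real r \<le> 1 / (4 * \<beta>\<^sup>2)" "1 / (4 * \<beta>\<^sup>2) < real r + 1"
    using \<beta> unfolding r_def by (simp_all add: of_nat_nat) 
  from stage[OF r(1)] obtain \<rho> where \<rho>: "colour_refines V \<rho> \<pi>" "\<rho> ` V \<subseteq> {..<m * 4 ^ r}"
      "bvar V \<rho> F \<le> ?n\<^sup>2 / 4 - real r * \<beta>\<^sup>2 * ?n\<^sup>2" by blast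
  from step[OF \<rho>(1,2) r(1)] obtain \<sigma> where "bvar V \<sigma> F < bvar V \<rho> F - \<beta>\<^sup>2 * ?n\<^sup>2" by blast
  hence "bvar V \<sigma> F < (1/4 - (real r + 1) * \<beta>\<^sup>2) * ?n\<^sup>2"
    using \<rho>(3) by (simp add: algebra_simps)
  also have "\<dots> \<le> 0"
  proof -
    have "1 \<le> (real r + 1) * (4 * \<beta>\<^sup>2)" using r(2) \<beta> by (simp add: field_simps)
    thus ?thesis by (intro mult_nonpos_nonneg) auto
  qed
  finally show False using bvar_nonneg[of V \<sigma> F] by simp
qed

subsection \<open>Equitable partitions\<close>

text \<open>The vertices are sorted by \<open>\<rho>\<close> and cut into \<open>M\<close> intervals
  of almost equal length. On an interval that meets two colours of \<open>\<rho>\<close> the colour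
  rises strictly from the first to the last vertex, so such intervals have distinct last colours and
  there are at most \<open>K\<close> of them.\<close>

lemma equitable_colouring:
  fixes V :: "'a set" and \<rho> :: "'a \<Rightarrow> nat"
  assumes V: "finite V" and M: "M > 0" and \<rho>: "\<rho> ` V \<subseteq> {..<K}"
  obtains \<pi> where "\<pi> ` V \<subseteq> {..<M}" "equitable_partition V M (\<lambda>a. {v\<in>V. \<pi> v = a})"
    "card {v\<in>V. \<exists>w\<in>V. \<pi> w = \<pi> v \<and> \<rho> w \<noteq> \<rho> v} \<le> K * (card V div M + 1)"
proof -
  define n where "n = card V"
  obtain ys where ys: "set ys = V" "distinct ys" using finite_distinct_list[OF V] by blast
  define xs where "xs = sort_key \<rho> ys"
  have xs: "set xs = V" "distinct xs" "sorted (map \<rho> xs)" using ys by (simp_all add: xs_def)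
  have len: "length xs = n" using distinct_card[OF xs(2)] xs(1) by (simp add: n_def)
  have mono\<rho>: "\<rho> (xs ! i) \<le> \<rho> (xs ! i')" if "i \<le> i'" "i' < n" for i i'
    using sorted_nth_mono[OF xs(3), of i i'] that len by simp
  \<comment> \<open>Consecutive cut points differ by \<open>n div M\<close> plus a carry of the
    remainders, \<open>0\<close> or \<open>1\<close>, which makes the parts equitable.\<close>
  define b where "b a = a * n div M" for a
  have b0: "b 0 = 0" and bM: "b M = n" using M by (simp_all add: b_def)
  have bmono: "b a \<le> b a'" if "a \<le> a'" for a a'
    unfolding b_def using that by (intro div_le_mono mult_right_mono) auto
  have bstep: "b (Suc a) = b a + n div M \<or> b (Suc a) = b a + n div M + 1" for a
  proof -
    have "(a * n mod M + n mod M) div M < 2"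
    proof (rule less_mult_imp_div_less)
      show "a * n mod M + n mod M < 2 * M"
        using mod_less_divisor[OF M, of "a * n"] mod_less_divisor[OF M, of n] by linarith
    qed
    moreover have "b (Suc a) = b a + n div M + (a * n mod M + n mod M) div M"
      unfolding b_def using div_add1_eq[of "a * n" n M] by (simp add: add.commute)
    ultimately show ?thesis by linarith
  qed
  have ex: "\<exists>a<M. b a \<le> i \<and> i < b (Suc a)" if i: "i < n" for i
  proof -
    have "i < b (Suc (M - 1))" using i bM M by simp
    hence P: "i < b (Suc (LEAST a. i < b (Suc a)))" by (rule LeastI)
    have le: "(LEAST a. i < b (Suc a)) \<le> M - 1" using \<open>i < b (Suc (M - 1))\<close> by (rule Least_le)
    have "b (LEAST a. i < b (Suc a)) \<le> i"
    proof (cases "LEAST a. i < b (Suc a)")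
      case (Suc c)
      hence "\<not> i < b (Suc c)" using not_less_Least[of c "\<lambda>a. i < b (Suc a)"] by simp
      thus ?thesis using Suc by simp
    qed (simp add: b0)
    thus ?thesis using P le M by (intro exI[of _ "LEAST a. i < b (Suc a)"]) linarith
  qed
  have uniq: "a = a'" if "b a \<le> i" "i < b (Suc a)" "b a' \<le> i" "i < b (Suc a')" for i a a'
  proof (rule ccontr)
    assume "a \<noteq> a'"
    hence "Suc a \<le> a' \<or> Suc a' \<le> a" by linarith
    thus False using that bmono[of "Suc a" a'] bmono[of "Suc a'" a] by linarith
  qed
  have "\<forall>i\<in>{..<n}. \<exists>a. a < M \<and> b a \<le> i \<and> i < b (Suc a)" using ex by blast
  then obtain c where c: "\<And>i. i < n \<Longrightarrow> c i < M \<and> b (c i) \<le> i \<and> i < b (Suc (c i))"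
    using bchoice[of "{..<n}" "\<lambda>i a. a < M \<and> b a \<le> i \<and> i < b (Suc a)"] by auto
  have bij: "bij_betw (nth xs) {..<n} V"
    using bij_betw_nth[OF xs(2), of "{..<n}" V] xs(1) len by simp
  define pos where "pos = inv_into {..<n} (nth xs)"
  have pos: "pos v < n" "xs ! pos v = v" if "v \<in> V" for v
    using bij_betw_inv_into_right[OF bij that] bij_betwE[OF bij_betw_inv_into[OF bij]] that
    by (auto simp: pos_def)
  have pos_nth: "pos (xs ! i) = i" if "i < n" for i
    unfolding pos_def using bij_betw_inv_into_left[OF bij] that by simp
  define \<pi> where "\<pi> v = c (pos v)" for v
  have \<pi>M: "\<pi> v < M" if "v \<in> V" for v using c[OF pos(1)[OF that]] by (simp add: \<pi>_def)
  have fib: "{v\<in>V. \<pi> v = a} = nth xs ` {b a..<b (Suc a)}" if a: "a < M" for a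
  proof (intro equalityI subsetI)
    fix v assume "v \<in> {v\<in>V. \<pi> v = a}"
    hence v: "v \<in> V" "c (pos v) = a" by (auto simp: \<pi>_def)
    have "pos v \<in> {b a..<b (Suc a)}" using c[OF pos(1)[OF v(1)]] v(2) by auto
    thus "v \<in> nth xs ` {b a..<b (Suc a)}" using pos(2)[OF v(1)] by (metis imageI)
  next
    fix v assume "v \<in> nth xs ` {b a..<b (Suc a)}"
    then obtain i where i: "v = xs ! i" "b a \<le> i" "i < b (Suc a)" by auto
    have "b (Suc a) \<le> n" using bmono[of "Suc a" M] a bM by simp
    hence "i < n" using i by linarith
    moreover have "c i = a" using uniq[of "c i" i a] c[OF \<open>i < n\<close>] i by auto
    ultimately show "v \<in> {v\<in>V. \<pi> v = a}"
      using i len xs(1) by (auto simp: \<pi>_def pos_nth)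
  qed
  have bn: "b (Suc a) \<le> n" if "a < M" for a using bmono[of "Suc a" M] that bM by simp
  have card_fib: "card {v\<in>V. \<pi> v = a} = b (Suc a) - b a" if a: "a < M" for a
  proof -
    have "inj_on (nth xs) {b a..<b (Suc a)}"
      using bij_betw_imp_inj_on[OF bij] bn[OF a] by (rule_tac inj_on_subset) auto
    thus ?thesis unfolding fib[OF a] by (simp add: card_image)
  qed
  have card_fib_le: "card {v\<in>V. \<pi> v = a} \<le> n div M + 1" if a: "a < M" for a
    using card_fib[OF a] bstep[of a] by linarith
  have eq: "equitable_partition V M (\<lambda>a. {v\<in>V. \<pi> v = a})"
    unfolding equitable_partition_def
  proof (intro conjI allI impI)
    show "disjoint_family_on (\<lambda>a. {v\<in>V. \<pi> v = a}) {..<M}" by (auto simp: disjoint_family_on_def)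
    show "(\<Union>a<M. {v\<in>V. \<pi> v = a}) = V" using \<pi>M by auto
    fix a a' assume a: "a < M" "a' < M"
    show "card {v\<in>V. \<pi> v = a} \<le> card {v\<in>V. \<pi> v = a'} + 1"
      unfolding card_fib[OF a(1)] card_fib[OF a(2)] using bstep[of a] bstep[of a'] by linarith
  qed
  define Q where "Q = {a. a < M \<and> (\<exists>v\<in>V. \<exists>w\<in>V. \<pi> v = a \<and> \<pi> w = a \<and> \<rho> w \<noteq> \<rho> v)}"
  have Qsub: "Q \<subseteq> {..<M}" by (auto simp: Q_def)
  hence Qfin: "finite Q" using finite_subset by blast
  define last where "last a = \<rho> (xs ! (b (Suc a) - 1))" for a
  have Qb: "b a < b (Suc a) \<and> \<rho> (xs ! b a) < last a" if aQ: "a \<in> Q" for a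
  proof -
    obtain v w where vw: "v \<in> V" "w \<in> V" "\<pi> v = a" "\<pi> w = a" "\<rho> w \<noteq> \<rho> v" and a: "a < M"
      using aQ by (auto simp: Q_def)
    have "v \<in> nth xs ` {b a..<b (Suc a)}" "w \<in> nth xs ` {b a..<b (Suc a)}"
      unfolding fib[OF a, symmetric] using vw by auto
    then obtain i i' where i: "v = xs ! i" "b a \<le> i" "i < b (Suc a)"
      and i': "w = xs ! i'" "b a \<le> i'" "i' < b (Suc a)" by auto
    have n: "i < n" "i' < n" "b (Suc a) - 1 < n" using i i' bn[OF a] by linarith+
    have "\<rho> (xs ! b a) \<le> \<rho> v" "\<rho> (xs ! b a) \<le> \<rho> w" "\<rho> v \<le> last a" "\<rho> w \<le> last a"
      unfolding last_def i(1) i'(1) using i i' n by (auto intro: mono\<rho>)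
    thus ?thesis using vw(5) i by linarith
  qed
  \<comment> \<open>The colour at position \<open>b a'\<close> is at least \<open>last a\<close>,
    and strictly below \<open>last a'\<close> because the interval \<open>a'\<close> is
    mixed.\<close>
  have last_less: "last a < last a'" if "a \<in> Q" "a' \<in> Q" "a < a'" for a a'
  proof -
    have a': "a' < M" using that Qsub by auto
    have "b (Suc a) - 1 \<le> b a'" using bmono[of "Suc a" a'] that by simp
    moreover have "b a' < n" using Qb[OF that(2)] bn[OF a'] by linarith
    ultimately have "last a \<le> \<rho> (xs ! b a')" unfolding last_def by (intro mono\<rho>)
    thus ?thesis using Qb[OF that(2)] by linarith
  qed
  have "inj_on last Q"
  proof (rule inj_onI)
    fix a a' assume "a \<in> Q" "a' \<in> Q" "last a = last a'"
    thus "a = a'" using last_less[of a a'] last_less[of a' a] by (cases a a' rule: linorder_cases) auto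
  qed
  moreover have "last ` Q \<subseteq> {..<K}"
  proof
    fix x assume "x \<in> last ` Q"
    then obtain a where a: "a \<in> Q" "x = last a" by auto
    have "b (Suc a) - 1 < n" using Qb[OF a(1)] bn[of a] a(1) Qsub by (auto simp: subset_iff)
    hence "xs ! (b (Suc a) - 1) \<in> V" using xs(1) len by auto
    thus "x \<in> {..<K}" using \<rho> a(2) by (auto simp: last_def)
  qed
  ultimately have Qcard: "card Q \<le> K" using card_inj_on_le[of last Q "{..<K}"] by simp
  have "{v\<in>V. \<exists>w\<in>V. \<pi> w = \<pi> v \<and> \<rho> w \<noteq> \<rho> v} \<subseteq> (\<Union>a\<in>Q. {v\<in>V. \<pi> v = a})"
    using \<pi>M by (auto simp: Q_def)
  hence "card {v\<in>V. \<exists>w\<in>V. \<pi> w = \<pi> v \<and> \<rho> w \<noteq> \<rho> v} \<le> card (\<Union>a\<in>Q. {v\<in>V. \<pi> v = a})"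
    using V Qfin by (intro card_mono) auto
  also have "\<dots> \<le> (\<Sum>a\<in>Q. card {v\<in>V. \<pi> v = a})" by (rule card_UN_le[OF Qfin])
  also have "\<dots> \<le> card Q * (n div M + 1)"
    using sum_bounded_above[of Q "\<lambda>a. card {v\<in>V. \<pi> v = a}" "n div M + 1"] card_fib_le Qsub by auto
  also have "\<dots> \<le> K * (n div M + 1)" using Qcard by (intro mult_right_mono) auto
  finally show ?thesis using \<pi>M eq by (intro that[of \<pi>]) (auto simp: n_def)
qed

text \<open>Outside the set \<open>D\<close> of vertices in mixed classes, the colour under
  \<open>\<pi>\<close> determines the colour under \<open>\<rho>\<close>, so averages over
  \<open>\<rho>\<close> can be read off \<open>\<pi>\<close>. A pair that meets \<open>D\<close>
  costs at most 1, and there are at most \<open>2 * card D * card V\<close> of these.\<close>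

lemma bvar_coarsen:
  fixes V :: "'a set" and F :: "'a \<times> 'a \<Rightarrow> real"
  assumes V: "finite V" and F: "\<And>z. z \<in> V \<times> V \<Longrightarrow> F z \<in> {0..1}"
  shows "bvar V \<pi> F \<le> bvar V \<rho> F
    + 2 * real (card {v\<in>V. \<exists>w\<in>V. \<pi> w = \<pi> v \<and> \<rho> w \<noteq> \<rho> v}) * real (card V)"
proof -
  define D where "D = {v\<in>V. \<exists>w\<in>V. \<pi> w = \<pi> v \<and> \<rho> w \<noteq> \<rho> v}"
  define r where "r a = (SOME v. v \<in> V \<and> \<pi> v = a)" for a
  have r: "r (\<pi> v) \<in> V \<and> \<pi> (r (\<pi> v)) = \<pi> v" if "v \<in> V" for v
    unfolding r_def by (rule someI[of _ v]) (use that in simp)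
  have pure: "\<rho> (r (\<pi> v)) = \<rho> v" if "v \<in> V" "v \<notin> D" for v
    using that r[of v] unfolding D_def by blast
  \<comment> \<open>Evaluation at class representatives makes \<open>W\<close> constant on the
    blocks of \<open>\<pi>\<close>, as \<open>bvar_le\<close> demands; for pairs that meet
    \<open>D\<close> only \<open>W z \<in> {0..1}\<close> matters.\<close>
  define W where "W z = bavg V \<rho> F (map_prod r r (map_prod \<pi> \<pi> z))" for z
  have W01: "W z \<in> {0..1}" for z unfolding W_def by (rule bavg_bounds[OF V F])
  have "bvar V \<pi> F \<le> (\<Sum>z\<in>V \<times> V. (F z - W z)\<^sup>2)"
    by (rule bvar_le[OF V]) (simp add: W_def)
  also have "\<dots> \<le> (\<Sum>z\<in>V \<times> V. (F z - bavg V \<rho> F z)\<^sup>2 + (of_bool (fst z \<in> D) + of_bool (snd z \<in> D)))"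
  proof (intro sum_mono)
    fix z assume z: "z \<in> V \<times> V"
    show "(F z - W z)\<^sup>2 \<le> (F z - bavg V \<rho> F z)\<^sup>2 + (of_bool (fst z \<in> D) + of_bool (snd z \<in> D))"
    proof (cases "fst z \<in> D \<or> snd z \<in> D")
      case True
      have "\<bar>F z - W z\<bar> \<le> 1" using F[OF z] W01[of z] by auto
      hence "(F z - W z)\<^sup>2 \<le> 1" by (simp add: abs_square_le_1)
      moreover have "1 \<le> (of_bool (fst z \<in> D) + of_bool (snd z \<in> D) :: real)" using True by auto
      moreover have "0 \<le> (F z - bavg V \<rho> F z)\<^sup>2" by simp
      ultimately show ?thesis by linarith
    next
      case False
      have "W z = bavg V \<rho> F z"
        unfolding W_def bavg_def
      proof (rule cavg_cong_key)
        show "map_prod \<rho> \<rho> (map_prod r r (map_prod \<pi> \<pi> z)) = map_prod \<rho> \<rho> z"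
          using z False pure[of "fst z"] pure[of "snd z"] by (cases z) simp
      qed
      thus ?thesis by simp
    qed
  qed
  also have "\<dots> = bvar V \<rho> F + ((\<Sum>z\<in>V \<times> V. of_bool (fst z \<in> D)) + (\<Sum>z\<in>V \<times> V. of_bool (snd z \<in> D)))"
    by (simp add: sum.distrib bvar_def)
  also have "(\<Sum>z\<in>V \<times> V. of_bool (fst z \<in> D)) = real (card (D \<times> V))"
  proof -
    have e: "V \<times> V \<inter> {z. fst z \<in> D} = D \<times> V" by (auto simp: D_def)
    show ?thesis unfolding e[symmetric] by (intro sum_of_bool_eq finite_cartesian_product V)
  qed
  also have "(\<Sum>z\<in>V \<times> V. of_bool (snd z \<in> D)) = real (card (V \<times> D))"
  proof -
    have e: "V \<times> V \<inter> {z. snd z \<in> D} = V \<times> D" by (auto simp: D_def)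
    show ?thesis unfolding e[symmetric] by (intro sum_of_bool_eq finite_cartesian_product V)
  qed
  finally show ?thesis by (simp add: card_cartesian_product D_def mult_ac)
qed

lemma bavg_swap:
  assumes F: "\<And>x y. F (x, y) = F (y, x)"
  shows "bavg V \<pi> F (y, x) = bavg V \<pi> F (x, y)"
proof -
  let ?S = "\<lambda>x y. {z\<in>V \<times> V. map_prod \<pi> \<pi> z = map_prod \<pi> \<pi> (x, y)}"
  have bij: "bij_betw prod.swap (?S x y) (?S y x)"
    by (rule bij_betw_byWitness[where f' = prod.swap]) auto
  have "sum F (?S y x) = (\<Sum>z\<in>?S x y. F (prod.swap z))"
    by (rule sum.reindex_bij_betw[OF bij, symmetric])
  also have "\<dots> = sum F (?S x y)" by (intro sum.cong refl) (auto simp: F)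
  finally show ?thesis unfolding bavg_def cavg_def using bij_betw_same_card[OF bij] by simp
qed

subsection \<open>From weights to graphs\<close>

text \<open>The count of tests for the rounding: \<open>4 ^ n\<close> pairs of vertex sets and one
  test for the edit distance, doubled for the two signs. With \<open>exp 2 \<ge> 25/4\<close>, the
  ratio \<open>(25/16) ^ n\<close> exceeds 4 from \<open>n = 4\<close> on.\<close>

lemma four_pow_le_exp:
  assumes "4 \<le> n"
  shows "2 * ((4 :: real) ^ n + 1) \<le> exp (2 * real n)"
proof -
  have e: "(25 / 4 :: real) \<le> exp 2"
  proof -
    have "(5/2 :: real) \<le> exp 1" using exp_lower_Taylor_quadratic[of 1] by simp
    hence "(5/2 :: real)\<^sup>2 \<le> (exp 1)\<^sup>2" by (intro power_mono) auto
    moreover have "(exp 1)\<^sup>2 = exp (2 :: real)" by (simp add: power2_eq_square mult_exp_exp)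
    ultimately show ?thesis by (simp add: power2_eq_square)
  qed
  have "(4 :: real) * 4 ^ n \<le> (25 / 4) ^ n" using assms
  proof (induction n rule: dec_induct)
    case (step n)
    have "(4 :: real) * 4 ^ Suc n \<le> (25 / 4) * (4 * 4 ^ n)" by simp
    also have "\<dots> \<le> (25 / 4) * (25 / 4) ^ n" using step by (intro mult_left_mono) auto
    finally show ?case by simp
  qed (simp add: power_numeral_reduce)
  also have "\<dots> \<le> exp 2 ^ n" using e by (intro power_mono) auto
  also have "\<dots> = exp (2 * real n)" by (simp add: exp_of_nat_mult[symmetric] mult.commute)
  finally have "4 * (4 :: real) ^ n \<le> exp (2 * real n)" .
  moreover have "2 * (x + 1) \<le> 4 * x" if "1 \<le> x" for x :: real using that by simp
  ultimately show ?thesis by (metis one_le_numeral one_le_power order_trans)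
qed

text \<open>Each unordered pair has two preimages, distinct as \<open>x \<noteq> y\<close>. This
  gives the factor \<open>1/2\<close> when edits are compared with a sum over ordered pairs.\<close>

lemma sum_unordered_le:
  fixes h :: "'a set \<Rightarrow> real"
  assumes V: "finite V" and h: "\<And>e. 0 \<le> h e" and Z: "Z \<subseteq> V \<times> V"
    and sym: "\<And>x y. (x, y) \<in> Z \<Longrightarrow> (y, x) \<in> Z \<and> x \<noteq> y"
  shows "2 * (\<Sum>e\<in>(\<lambda>z. {fst z, snd z}) ` Z. h e) \<le> (\<Sum>z\<in>V \<times> V. h {fst z, snd z})"
proof -
  let ?u = "\<lambda>z. {fst z, snd z}"
  have Zf: "finite Z" using V Z finite_subset by blast
  have "(\<Sum>e\<in>?u ` Z. 2 * h e) \<le> (\<Sum>e\<in>?u ` Z. \<Sum>z\<in>{z\<in>Z. ?u z = e}. h (?u z))"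
  proof (intro sum_mono)
    fix e assume "e \<in> ?u ` Z"
    then obtain z where "z \<in> Z" "e = ?u z" by blast
    then obtain x y where xy: "(x, y) \<in> Z" "e = {x, y}" by (metis prod.collapse)
    have ne: "x \<noteq> y" "(y, x) \<in> Z" using sym[OF xy(1)] by auto
    have "2 * h e = (\<Sum>z\<in>{(x, y), (y, x)}. h (?u z))"
      using ne xy by (simp add: insert_commute)
    also have "\<dots> \<le> (\<Sum>z\<in>{z\<in>Z. ?u z = e}. h (?u z))"
      using Zf h xy ne by (intro sum_mono2) auto
    finally show "2 * h e \<le> (\<Sum>z\<in>{z\<in>Z. ?u z = e}. h (?u z))" .
  qed
  also have "\<dots> = (\<Sum>z\<in>Z. h (?u z))" using Zf by (intro sum.group) auto
  also have "\<dots> \<le> (\<Sum>z\<in>V \<times> V. h (?u z))" using V Z h by (intro sum_mono2) auto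
  finally show ?thesis by (simp add: sum_distrib_left)
qed

text \<open>Pairs of different colours are rounded with edge probabilities \<open>f\<close>; pairs
  inside a class keep their status in \<open>E\<close>. The tests are the cuts \<open>(A, B)\<close>
  and the number of edits.\<close>

lemma graph_rounding:
  fixes V :: "'a set" and E :: "'a set set" and f :: "'a \<times> 'a \<Rightarrow> real" and \<pi> :: "'a \<Rightarrow> nat"
  assumes VE: "fin_graph V E" and n: "4 \<le> card V"
    and f: "\<And>z. z \<in> V \<times> V \<Longrightarrow> f z \<in> {0..1}" and sym: "\<And>x y. f (x, y) = f (y, x)"
    and l: "0 < l" "l \<le> 1"
    and \<eta>: "\<eta> = 2 * real (card V) / l + l * (real (card V))\<^sup>2 / 4"
  obtains E' where "fin_graph V E'"
    "real (card ((E - E') \<union> (E' - E)))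
      \<le> (\<Sum>z\<in>V \<times> V. \<bar>f z - of_bool ({fst z, snd z} \<in> E)\<bar>) / 2 + \<eta>"
    "\<And>A B. A \<subseteq> V \<Longrightarrow> B \<subseteq> V \<Longrightarrow> (\<And>x y. x \<in> A \<Longrightarrow> y \<in> B \<Longrightarrow> \<pi> x \<noteq> \<pi> y) \<Longrightarrow>
      \<bar>real (edges_between E' A B) - (\<Sum>z\<in>A \<times> B. f z)\<bar> \<le> \<eta>"
proof -
  have V: "finite V" using VE by (simp add: fin_graph_def)
  let ?u = "\<lambda>z. {fst z, snd z}"
  define Z where "Z = {z\<in>V \<times> V. \<pi> (fst z) \<noteq> \<pi> (snd z)}"
  define I where "I = ?u ` Z"
  have Zf: "finite Z" unfolding Z_def using V by auto
  have If: "finite I" by (simp add: I_def Zf)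
  have "card I \<le> card Z" unfolding I_def by (rule card_image_le[OF Zf])
  also have "card Z \<le> card (V \<times> V)" unfolding Z_def using V by (intro card_mono) auto
  finally have Icard: "real (card I) \<le> (real (card V))\<^sup>2"
    by (simp add: card_cartesian_product power2_eq_square of_nat_mult[symmetric] del: of_nat_mult)
  \<comment> \<open>\<open>f\<close> moves to unordered pairs by a choice of orientation, which its
    symmetry makes irrelevant.\<close>
  define p where "p e = f (SOME z. z \<in> Z \<and> ?u z = e)" for e
  have p: "p {x, y} = f (x, y)" if "(x, y) \<in> Z" for x y
  proof -
    define z where "z = (SOME z. z \<in> Z \<and> ?u z = {x, y})"
    have "z \<in> Z \<and> ?u z = {x, y}" unfolding z_def by (rule someI[of _ "(x, y)"]) (use that in simp)
    hence "z = (x, y) \<or> z = (y, x)" by (cases z) (auto simp: doubleton_eq_iff)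
    hence "f z = f (x, y)" using sym[of x y] by (elim disjE) simp_all
    thus ?thesis by (simp add: p_def z_def)
  qed
  have p01: "p e \<in> {0..1}" if e: "e \<in> I" for e
  proof -
    obtain z where "z \<in> Z" "e = ?u z" using e unfolding I_def by blast
    then obtain x y where xy: "(x, y) \<in> Z" "e = {x, y}" by (metis prod.collapse)
    thus ?thesis using p[OF xy(1)] f[of "(x, y)"] by (simp add: Z_def)
  qed
  define J where "J = insert None (Some ` (Pow V \<times> Pow V))"
  \<comment> \<open>\<open>None\<close> is the edit test: an edge of \<open>E\<close> is edited if
    it is dropped, a non-edge if it is chosen, whence the sign. \<open>Some (A, B)\<close> counts
    the edges between \<open>A\<close> and \<open>B\<close>.\<close>
  define c where "c j e = (case j of None \<Rightarrow> (if e \<in> E then -1 else 1 :: real)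
      | Some AB \<Rightarrow> of_bool (e \<in> ?u ` (fst AB \<times> snd AB)))" for j e
  have c1: "\<bar>c j e\<bar> \<le> 1" for j e by (auto simp: c_def split: option.split)
  have Jf: "finite J" using V by (simp add: J_def)
  have "card J \<le> card (Some ` (Pow V \<times> Pow V)) + 1" unfolding J_def using V by (simp add: card_insert_if)
  also have "card (Some ` (Pow V \<times> Pow V)) = 4 ^ card V"
    using V by (simp add: card_image card_cartesian_product card_Pow power_mult_distrib[symmetric])
  finally have "2 * real (card J) \<le> 2 * (4 ^ card V + 1)"
    by (metis (mono_tags) of_nat_le_iff of_nat_add of_nat_power of_nat_1 of_nat_numeral mult_left_mono zero_le_numeral)
  also have "\<dots> \<le> exp (2 * real (card V))" by (rule four_pow_le_exp[OF n])
  finally have le: "2 * real (card J) \<le> exp (2 * real (card V))" .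
  have "card J > 0" using Jf by (auto simp: card_gt_0_iff J_def)
  hence Jln: "ln (2 * real (card J)) \<le> 2 * real (card V)"
    using le by (simp add: ln_le_cancel_iff[symmetric] del: ln_le_cancel_iff)
  obtain X where X: "X \<subseteq> I" and dev: "\<And>j. j \<in> J \<Longrightarrow>
    \<bar>\<Sum>e\<in>I. c j e * (of_bool (e \<in> X) - p e)\<bar> \<le> ln (2 * real (card J)) / l + l * real (card I) / 4"
    by (rule rounding[where I = I and J = J and p = p and c = c and l = l])
      ((assumption | rule If Jf p01 c1 l)+, blast)
  have dev\<eta>: "\<bar>\<Sum>e\<in>I. c j e * (of_bool (e \<in> X) - p e)\<bar> \<le> \<eta>" if "j \<in> J" for j
  proof -
    have "ln (2 * real (card J)) / l + l * real (card I) / 4 \<le> \<eta>"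
      unfolding \<eta> using Jln Icard l
      by (intro add_mono divide_right_mono mult_left_mono) auto
    thus ?thesis using dev[OF that] by linarith
  qed
  define E' where "E' = (E - I) \<union> X"
  have E'I: "e \<in> E' \<longleftrightarrow> e \<in> X" if "e \<in> I" for e using that by (auto simp: E'_def)
  have "fin_graph V E'"
    unfolding fin_graph_def
  proof (intro conjI V ballI)
    fix e assume e: "e \<in> E'"
    show "\<exists>u\<in>V. \<exists>v\<in>V. u \<noteq> v \<and> e = {u, v}"
    proof (cases "e \<in> X")
      case True
      then obtain z where "z \<in> Z" "e = ?u z" using X unfolding I_def by blast
      thus ?thesis by (intro bexI[of _ "fst z"] bexI[of _ "snd z"]) (auto simp: Z_def)
    next
      case False
      thus ?thesis using e VE by (auto simp: E'_def fin_graph_def)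
    qed
  qed
  moreover have "real (card ((E - E') \<union> (E' - E)))
      \<le> (\<Sum>z\<in>V \<times> V. \<bar>f z - of_bool ({fst z, snd z} \<in> E)\<bar>) / 2 + \<eta>"
  proof -
    \<comment> \<open>On \<open>I\<close>, \<open>h e\<close> is the probability that
      \<open>e\<close> is edited; the indicator of an edit differs from it by the summand of the
      \<open>None\<close> test.\<close>
    define h where "h e = (if e \<in> I then \<bar>p e - of_bool (e \<in> E)\<bar> else 0)" for e
    have "(E - E') \<union> (E' - E) = {e\<in>I. (e \<in> E) \<noteq> (e \<in> X)}"
      using X by (auto simp: E'_def)
    hence "real (card ((E - E') \<union> (E' - E))) = (\<Sum>e\<in>I. of_bool ((e \<in> E) \<noteq> (e \<in> X)))"
      using If by (simp add: sum_of_bool_eq Int_def)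
    also have "\<dots> = (\<Sum>e\<in>I. c None e * (of_bool (e \<in> X) - p e) + h e)"
      using p01 by (intro sum.cong refl) (auto simp: c_def h_def)
    also have "\<dots> = (\<Sum>e\<in>I. c None e * (of_bool (e \<in> X) - p e)) + (\<Sum>e\<in>I. h e)"
      by (rule sum.distrib)
    also have "\<dots> \<le> \<eta> + (\<Sum>e\<in>I. h e)"
      using dev\<eta>[of None] by (simp add: J_def)
    finally have le: "real (card ((E - E') \<union> (E' - E))) \<le> \<eta> + (\<Sum>e\<in>I. h e)" .
    have "2 * (\<Sum>e\<in>I. h e) \<le> (\<Sum>z\<in>V \<times> V. h (?u z))"
      unfolding I_def by (rule sum_unordered_le[OF V]) (auto simp: Z_def h_def)
    also have "(\<Sum>z\<in>V \<times> V. h (?u z)) \<le> (\<Sum>z\<in>V \<times> V. \<bar>f z - of_bool (?u z \<in> E)\<bar>)"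
    proof (intro sum_mono)
      fix z assume z: "z \<in> V \<times> V"
      show "h (?u z) \<le> \<bar>f z - of_bool (?u z \<in> E)\<bar>"
      proof (cases "?u z \<in> I")
        case True
        then obtain w where w: "w \<in> Z" "?u z = ?u w" unfolding I_def by blast
        have "z \<in> Z" using z w by (cases z; cases w) (auto simp: Z_def doubleton_eq_iff)
        thus ?thesis using p[of "fst z" "snd z"] True by (simp add: h_def)
      qed (simp add: h_def)
    qed
    finally show ?thesis using le by simp
  qed
  moreover have "\<bar>real (edges_between E' A B) - (\<Sum>z\<in>A \<times> B. f z)\<bar> \<le> \<eta>"
    if A: "A \<subseteq> V" and B: "B \<subseteq> V" and sep: "\<And>x y. x \<in> A \<Longrightarrow> y \<in> B \<Longrightarrow> \<pi> x \<noteq> \<pi> y" for A B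
  proof -
    have AB: "A \<times> B \<subseteq> Z" using A B sep by (auto simp: Z_def)
    have ABf: "finite (A \<times> B)" using AB Zf by (rule finite_subset)
    \<comment> \<open>\<open>A\<close> and \<open>B\<close> share no colour, so no edge between them
      is counted in both orientations.\<close>
    have inj: "inj_on ?u (A \<times> B)"
    proof (rule inj_onI)
      fix z w assume zw: "z \<in> A \<times> B" "w \<in> A \<times> B" "?u z = ?u w"
      obtain x y x' y' where [simp]: "z = (x, y)" "w = (x', y')" by (cases z; cases w)
      have "\<not> (x = y' \<and> y = x')" using zw sep[of x y] sep[of x' y] by auto
      thus "z = w" using zw(3) by (auto simp: doubleton_eq_iff)
    qed
    have "real (edges_between E' A B) = (\<Sum>z\<in>A \<times> B. of_bool (?u z \<in> E'))"
    proof -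
      have "{(x, y) \<in> A \<times> B. {x, y} \<in> E'} = A \<times> B \<inter> {z. ?u z \<in> E'}" by auto
      thus ?thesis unfolding edges_between_def using ABf by (simp add: sum_of_bool_eq)
    qed
    also have "\<dots> - (\<Sum>z\<in>A \<times> B. f z) = (\<Sum>z\<in>A \<times> B. of_bool (?u z \<in> X) - p (?u z))"
      unfolding sum_subtractf[symmetric]
    proof (intro sum.cong refl)
      fix z assume "z \<in> A \<times> B"
      hence z: "z \<in> Z" "?u z \<in> I" using AB by (auto simp: I_def)
      thus "of_bool (?u z \<in> E') - f z = of_bool (?u z \<in> X) - p (?u z)"
        using p[of "fst z" "snd z"] E'I[OF z(2)] by simp
    qed
    also have "\<dots> = (\<Sum>e\<in>?u ` (A \<times> B). of_bool (e \<in> X) - p e)"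
      by (rule sum.reindex_cong[OF inj, symmetric]) auto
    also have "\<dots> = (\<Sum>e\<in>I. c (Some (A, B)) e * (of_bool (e \<in> X) - p e))"
      using If AB by (intro sum.mono_neutral_cong_left) (auto simp: c_def I_def)
    finally show ?thesis using dev\<eta>[of "Some (A, B)"] A B by (simp add: J_def)
  qed
  ultimately show ?thesis by (rule that)
qed

text \<open>For the admissible subsets \<open>card A * card B\<close> is at least
  \<open>\<gamma>\<^sup>2 * card P * card Q\<close>, so the absolute error \<open>\<kappa>\<close>
  amounts to at most \<open>\<gamma> / 2\<close> in density. Both densities are compared with
  \<open>c\<close>.\<close>

lemma regular_pair_if_near_constant:
  assumes near: "\<And>A B. A \<subseteq> P \<Longrightarrow> B \<subseteq> Q \<Longrightarrow>
      \<bar>real (edges_between E A B) - c * (real (card A) * real (card B))\<bar> \<le> \<kappa>"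
    and \<gamma>: "0 < \<gamma>" "\<gamma> < 1" and PQ: "0 < card P" "0 < card Q"
    and \<kappa>: "\<kappa> \<le> \<gamma> ^ 3 / 2 * (real (card P) * real (card Q))"
  shows "regular_pair \<gamma> E P Q"
proof -
  have dens: "\<bar>density E A B - c\<bar> \<le> \<gamma> / 2"
    if AB: "A \<subseteq> P" "B \<subseteq> Q" "\<gamma> * real (card P) \<le> real (card A)" "\<gamma> * real (card Q) \<le> real (card B)" for A B
  proof -
    define w where "w = real (card A) * real (card B)"
    have pos: "0 < \<gamma> * real (card P)" "0 < \<gamma> * real (card Q)" using \<gamma> PQ by auto
    hence w: "w > 0" using AB unfolding w_def by (intro mult_pos_pos) linarith+
    have "(\<gamma> * real (card P)) * (\<gamma> * real (card Q)) \<le> w"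
      unfolding w_def using AB pos by (intro mult_mono) auto
    hence "\<gamma> / 2 * ((\<gamma> * real (card P)) * (\<gamma> * real (card Q))) \<le> \<gamma> / 2 * w"
      using \<gamma> by (intro mult_left_mono) auto
    hence "\<kappa> \<le> \<gamma> / 2 * w" using \<kappa> by (simp add: power3_eq_cube mult_ac)
    hence "\<bar>real (edges_between E A B) - c * w\<bar> \<le> \<gamma> / 2 * w"
      using near[OF AB(1,2)] by (simp add: w_def)
    moreover have "density E A B - c = (real (edges_between E A B) - c * w) / w"
      using w by (simp add: density_def w_def[symmetric] field_simps)
    ultimately show ?thesis using w by (simp add: divide_le_eq)
  qed
  have PQc: "\<bar>density E P Q - c\<bar> \<le> \<gamma> / 2"
    using \<gamma> by (intro dens) (auto intro: mult_left_le_one_le)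
  show ?thesis
    unfolding regular_pair_def
  proof (intro allI impI)
    fix A B
    assume "A \<subseteq> P" "B \<subseteq> Q" "real (card A) \<ge> \<gamma> * real (card P)" "real (card B) \<ge> \<gamma> * real (card Q)"
    thus "\<bar>density E A B - density E P Q\<bar> \<le> \<gamma>" using dens[of A B] PQc by linarith
  qed
qed

text \<open>The alternatives are the two outcomes for a calibrated refinement of
  \<open>\<pi>\<close>: little energy gained, or much. In the first, the error between two classes
  is the calibration error \<open>\<beta>\<close> plus the rounding error
  \<open>\<eta>\<close>.\<close>

lemma regularisation_dichotomy:
  fixes V :: "'a set" and E :: "'a set set" and \<pi> :: "'a \<Rightarrow> nat"
  defines "G \<equiv> \<lambda>z. of_bool ({fst z, snd z} \<in> E)"
  assumes VE: "fin_graph V E" and n: "4 \<le> card V" and \<pi>: "\<pi> ` V \<subseteq> {..<m}"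
    and \<beta>: "0 < \<beta>" and \<epsilon>: "0 < \<epsilon>" and l: "0 < l" "l \<le> 1"
    and \<eta>: "\<eta> = 2 * real (card V) / l + l * (real (card V))\<^sup>2 / 4"
  obtains
    (regular) E' c where "fin_graph V E'"
      "real (card ((E - E') \<union> (E' - E))) \<le> 3/4 * \<epsilon> * (real (card V))\<^sup>2 + \<eta>"
      "\<And>a b A B. a \<noteq> b \<Longrightarrow> A \<subseteq> {v\<in>V. \<pi> v = a} \<Longrightarrow> B \<subseteq> {v\<in>V. \<pi> v = b} \<Longrightarrow>
        \<bar>real (edges_between E' A B) - c a b * (real (card A) * real (card B))\<bar>
          \<le> \<beta> * (real (card V))\<^sup>2 + \<eta>"
  | (refine) \<rho> r where "\<rho> ` V \<subseteq> {..<m * 4 ^ r}" "real r \<le> 1 / (4 * \<beta>\<^sup>2)"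
      "bvar V \<rho> G < bvar V \<pi> G - 2 * \<epsilon>\<^sup>2 * (real (card V))\<^sup>2"
proof -
  have V: "finite V" using VE by (simp add: fin_graph_def)
  let ?n = "real (card V)"
  have G01: "G z \<in> {0..1}" for z by (simp add: G_def)
  have G01': "G z \<in> {0..1}" if "z \<in> V \<times> V" for z by (rule G01)
  have Gsym: "G (x, y) = G (y, x)" for x y by (simp add: G_def insert_commute)
  show ?thesis
  proof (rule calibrated_refinement[OF V G01' \<pi> \<beta>])
    fix \<rho> r
    assume ref: "colour_refines V \<rho> \<pi>" and \<rho>: "\<rho> ` V \<subseteq> {..<m * 4 ^ r}"
      and r: "real r \<le> 1 / (4 * \<beta>\<^sup>2)"
      and cal: "\<And>A B. A \<subseteq> V \<Longrightarrow> B \<subseteq> V \<Longrightarrow>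
        \<bar>\<Sum>z\<in>A \<times> B. theta (bavg V \<rho> G z) (bavg V \<pi> G z) * (G z - bavg V \<rho> G z)\<bar> \<le> \<beta> * ?n\<^sup>2"
  show ?thesis
  proof (cases "bvar V \<rho> G < bvar V \<pi> G - 2 * \<epsilon>\<^sup>2 * ?n\<^sup>2")
    case True
    thus ?thesis using refine[OF \<rho> r] by blast
  next
    case False
    define p where "p = bavg V \<pi> G"
    define q where "q = bavg V \<rho> G"
    have p01: "p z \<in> {0..1}" and q01: "q z \<in> {0..1}" for z
      unfolding p_def q_def by (rule bavg_bounds[OF V G01'], assumption)+
    define f where "f z = p z + theta (q z) (p z) * (G z - q z)" for z
    have f01: "f z \<in> {0..1}" for z unfolding f_def by (rule theta_shift_bounds[OF q01 p01 G01])
    have fsym: "f (x, y) = f (y, x)" for x y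
      unfolding f_def p_def q_def
      by (simp only: Gsym[of x y] bavg_swap[of G V \<pi> x y, OF Gsym] bavg_swap[of G V \<rho> x y, OF Gsym])
    \<comment> \<open>The coefficient of \<open>G - q\<close> in \<open>theta_shift_dist\<close>.
      Being a function of \<open>p\<close> and \<open>q\<close>, it is constant on the blocks of
      \<open>\<rho>\<close>, hence orthogonal to \<open>G - q\<close>, and the distance of
      \<open>f\<close> from \<open>G\<close> collapses to that of \<open>p\<close> from
      \<open>q\<close>.\<close>
    define W where "W z = (if p z \<le> q z then 1 else -1) * (1 - theta (q z) (p z))" for z
    have "(\<Sum>z\<in>V \<times> V. W z * q z) = (\<Sum>z\<in>V \<times> V. W z * G z)"
      unfolding q_def bavg_def
    proof (rule sum_mult_cavg)
      fix z w assume zw: "z \<in> V \<times> V" "w \<in> V \<times> V" "map_prod \<rho> \<rho> z = map_prod \<rho> \<rho> w"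
      have "p z = p w" "q z = q w"
        unfolding p_def q_def
        by (rule bavg_cong_refines[OF ref zw], rule bavg_cong_refines[OF colour_refines_refl zw])
      thus "W z = W w" by (simp add: W_def)
    qed (use V in simp)
    hence W0: "(\<Sum>z\<in>V \<times> V. W z * (G z - q z)) = 0" by (simp add: algebra_simps sum_subtractf)
    have "(\<Sum>z\<in>V \<times> V. \<bar>f z - G z\<bar>) = (\<Sum>z\<in>V \<times> V. \<bar>p z - q z\<bar> + W z * (G z - q z))"
      unfolding f_def W_def using theta_shift_dist[OF q01 p01 G01] by (intro sum.cong refl) auto
    also have "\<dots> = (\<Sum>z\<in>V \<times> V. \<bar>p z - q z\<bar>)" by (simp add: sum.distrib W0)
    finally have fG: "(\<Sum>z\<in>V \<times> V. \<bar>f z - G z\<bar>) = (\<Sum>z\<in>V \<times> V. \<bar>p z - q z\<bar>)" .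
    have "(\<Sum>z\<in>V \<times> V. \<bar>p z - q z\<bar>\<^sup>2) = (\<Sum>z\<in>V \<times> V. (q z - p z)\<^sup>2)"
      by (intro sum.cong refl) (simp add: power2_commute)
    also have "\<dots> = bvar V \<pi> G - bvar V \<rho> G"
      unfolding p_def q_def by (rule bvar_diff_refines[OF V ref])
    finally have S: "(\<Sum>z\<in>V \<times> V. \<bar>p z - q z\<bar>\<^sup>2) \<le> 2 * \<epsilon>\<^sup>2 * ?n\<^sup>2" using False by linarith
    \<comment> \<open>Cauchy-Schwarz and \<open>sqrt 2 \<le> 3/2\<close>; halving for unordered
      pairs gives the \<open>3/4\<close> in the edit bound.\<close>
    have "(\<Sum>z\<in>V \<times> V. \<bar>p z - q z\<bar> * 1)\<^sup>2 \<le> (\<Sum>z\<in>V \<times> V. \<bar>p z - q z\<bar>\<^sup>2) * (\<Sum>z\<in>V \<times> V. 1\<^sup>2)"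
      by (rule Cauchy_Schwarz_ineq_sum)
    also have "\<dots> \<le> (2 * \<epsilon>\<^sup>2 * ?n\<^sup>2) * (\<Sum>z\<in>V \<times> V. 1\<^sup>2)"
      by (intro mult_right_mono S) (simp add: sum_nonneg)
    also have "\<dots> = 2 * (\<epsilon> * ?n\<^sup>2)\<^sup>2"
      by (simp add: card_cartesian_product power2_eq_square)
    also have "\<dots> \<le> (3/2 * (\<epsilon> * ?n\<^sup>2))\<^sup>2" by (simp add: power_mult_distrib power_divide)
    finally have "(\<Sum>z\<in>V \<times> V. \<bar>p z - q z\<bar>)\<^sup>2 \<le> (3/2 * (\<epsilon> * ?n\<^sup>2))\<^sup>2" by (simp only: mult_1_right)
    hence L1: "(\<Sum>z\<in>V \<times> V. \<bar>p z - q z\<bar>) \<le> 3/2 * (\<epsilon> * ?n\<^sup>2)"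
      by (rule power2_le_imp_le) (use \<epsilon> in simp)
    define c where "c a b = p (SOME z. z \<in> V \<times> V \<and> map_prod \<pi> \<pi> z = (a, b))" for a b
    have c: "p z = c a b" if z: "z \<in> V \<times> V" "map_prod \<pi> \<pi> z = (a, b)" for z a b
    proof -
      define w where "w = (SOME z. z \<in> V \<times> V \<and> map_prod \<pi> \<pi> z = (a, b))"
      have "w \<in> V \<times> V \<and> map_prod \<pi> \<pi> w = (a, b)" unfolding w_def by (rule someI[of _ z]) (use z in blast)
      hence "map_prod \<pi> \<pi> z = map_prod \<pi> \<pi> w" using z by simp
      hence "p z = p w" unfolding p_def bavg_def by (rule cavg_cong_key)
      thus ?thesis by (simp add: c_def w_def)
    qed
    show ?thesis
    proof (rule graph_rounding[where f = f and \<pi> = \<pi>, OF VE n _ fsym l \<eta>])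
      show "f z \<in> {0..1}" for z by (rule f01)
      fix E'
      assume E': "fin_graph V E'"
        "real (card ((E - E') \<union> (E' - E))) \<le> (\<Sum>z\<in>V \<times> V. \<bar>f z - of_bool ({fst z, snd z} \<in> E)\<bar>) / 2 + \<eta>"
        "\<And>A B. A \<subseteq> V \<Longrightarrow> B \<subseteq> V \<Longrightarrow> (\<And>x y. x \<in> A \<Longrightarrow> y \<in> B \<Longrightarrow> \<pi> x \<noteq> \<pi> y) \<Longrightarrow>
          \<bar>real (edges_between E' A B) - (\<Sum>z\<in>A \<times> B. f z)\<bar> \<le> \<eta>"
      show ?thesis
      proof (rule regular[OF E'(1)])
        show "real (card ((E - E') \<union> (E' - E))) \<le> 3/4 * \<epsilon> * ?n\<^sup>2 + \<eta>"
          using E'(2) L1 fG by (simp add: G_def)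
        fix a b A B
        assume ab: "a \<noteq> b" and A: "A \<subseteq> {v\<in>V. \<pi> v = a}" and B: "B \<subseteq> {v\<in>V. \<pi> v = b}"
        have AB: "A \<subseteq> V" "B \<subseteq> V" using A B by auto
        have sep: "\<pi> x \<noteq> \<pi> y" if "x \<in> A" "y \<in> B" for x y using that A B ab by auto
        have "(\<Sum>z\<in>A \<times> B. f z)
            = (\<Sum>z\<in>A \<times> B. c a b) + (\<Sum>z\<in>A \<times> B. theta (q z) (p z) * (G z - q z))"
          unfolding f_def sum.distrib[symmetric]
        proof (intro sum.cong refl arg_cong2[where f = "(+)"] c)
          fix z assume "z \<in> A \<times> B"
          thus "z \<in> V \<times> V" "map_prod \<pi> \<pi> z = (a, b)" using A B by auto
        qed
        moreover have "(\<Sum>z\<in>A \<times> B. c a b) = c a b * (real (card A) * real (card B))"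
          by (simp add: card_cartesian_product)
        moreover have "\<bar>\<Sum>z\<in>A \<times> B. theta (q z) (p z) * (G z - q z)\<bar> \<le> \<beta> * ?n\<^sup>2"
          unfolding p_def q_def by (rule cal[OF AB])
        moreover have "\<bar>real (edges_between E' A B) - (\<Sum>z\<in>A \<times> B. f z)\<bar> \<le> \<eta>"
          by (rule E'(3)[OF AB sep])
        ultimately show "\<bar>real (edges_between E' A B) - c a b * (real (card A) * real (card B))\<bar>
            \<le> \<beta> * ?n\<^sup>2 + \<eta>" by linarith
      qed
    qed
  qed
  qed
qed

text \<open>Because \<open>M \<le> card V\<close>, a part has at most \<open>2 * card V / M\<close>
  vertices. So at most \<open>2 * K * card V / M\<close> vertices lie in mixed classes, and each of
  them costs \<open>2 * card V\<close>.\<close>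

lemma equitable_coarsening:
  fixes V :: "'a set" and F :: "'a \<times> 'a \<Rightarrow> real"
  assumes V: "finite V" and F: "\<And>z. z \<in> V \<times> V \<Longrightarrow> F z \<in> {0..1}"
    and \<rho>: "\<rho> ` V \<subseteq> {..<K}" and M: "0 < M" "M \<le> card V" and K: "4 * real K \<le> x * real M"
  obtains \<pi> where "\<pi> ` V \<subseteq> {..<M}" "equitable_partition V M (\<lambda>a. {v\<in>V. \<pi> v = a})"
    "bvar V \<pi> F \<le> bvar V \<rho> F + x * (real (card V))\<^sup>2"
proof -
  let ?n = "real (card V)"
  obtain \<pi> where \<pi>: "\<pi> ` V \<subseteq> {..<M}" "equitable_partition V M (\<lambda>a. {v\<in>V. \<pi> v = a})"
    "card {v\<in>V. \<exists>w\<in>V. \<pi> w = \<pi> v \<and> \<rho> w \<noteq> \<rho> v} \<le> K * (card V div M + 1)"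
    by (rule equitable_colouring[OF V M(1) \<rho>])
  have "1 \<le> card V div M" using M by (simp add: Suc_leI div_greater_zero_iff)
  hence "K * (card V div M + 1) \<le> K * (2 * (card V div M))" by (intro mult_left_mono) auto
  hence "real (card {v\<in>V. \<exists>w\<in>V. \<pi> w = \<pi> v \<and> \<rho> w \<noteq> \<rho> v}) \<le> real (K * (2 * (card V div M)))"
    using \<pi>(3) by linarith
  also have "\<dots> = 2 * real K * real (card V div M)" by simp
  also have "\<dots> \<le> 2 * real K * (?n / real M)"
    by (intro mult_left_mono of_nat_div_le_of_nat) auto
  finally have imp: "real (card {v\<in>V. \<exists>w\<in>V. \<pi> w = \<pi> v \<and> \<rho> w \<noteq> \<rho> v}) \<le> 2 * real K * (?n / real M)" .
  have "bvar V \<pi> F \<le> bvar V \<rho> F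
      + 2 * real (card {v\<in>V. \<exists>w\<in>V. \<pi> w = \<pi> v \<and> \<rho> w \<noteq> \<rho> v}) * ?n"
    by (rule bvar_coarsen[OF V F])
  also have "\<dots> \<le> bvar V \<rho> F + 2 * (2 * real K * (?n / real M)) * ?n"
    using imp by (intro add_left_mono mult_right_mono mult_left_mono) auto
  also have "2 * (2 * real K * (?n / real M)) * ?n = 4 * real K / real M * ?n\<^sup>2"
    by (simp add: power2_eq_square)
  also have "\<dots> \<le> x * ?n\<^sup>2" using K M by (intro mult_right_mono) (auto simp: divide_le_eq)
  finally show ?thesis using that[OF \<pi>(1,2)] by simp
qed

subsection \<open>Lower bounds for the weak regularity lemma\<close>

text \<open>Witness: a single edge. With one part the predicted value between its ends is
  \<open>1/2\<close> instead of \<open>1\<close>, an error above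
  \<open>4 * \<alpha>\<close>.\<close>

lemma weak_regularity_bound_ge_2:
  assumes k: "weak_regularity_bound k" and \<alpha>: "0 < \<alpha>" "\<alpha> \<le> 1 / 32"
  shows "2 \<le> k \<alpha>"
proof -
  let ?V = "{0, 1 :: nat}" and ?E = "{{0, 1 :: nat}}"
  have "fin_graph ?V ?E" by (auto simp: fin_graph_def)
  then obtain m P where m: "m \<le> k \<alpha>" and P: "equitable_partition ?V m P" and wr: "weak_regular \<alpha> ?V ?E m P"
    using k \<alpha> unfolding weak_regularity_bound_def by blast
  have U: "(\<Union>i<m. P i) = ?V" using P by (simp add: equitable_partition_def)
  show ?thesis
  proof (rule ccontr)
    assume "\<not> 2 \<le> k \<alpha>"
    hence "m = 0 \<or> m = 1" using m by linarith
    hence m1: "m = 1" using U by auto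
    have PV: "P 0 = ?V" using U by (simp add: m1 lessThan_Suc)
    have e1: "edges_between ?E {0} {1} = 1"
    proof -
      have "{(x, y) \<in> {0} \<times> {1}. {x, y} \<in> ?E} = {(0, 1)}" by auto
      thus ?thesis by (simp add: edges_between_def)
    qed
    have e2: "edges_between ?E ?V ?V = 2"
    proof -
      have "{(x, y) \<in> ?V \<times> ?V. {x, y} \<in> ?E} = {(0, 1), (1, 0)}" by (auto simp: doubleton_eq_iff)
      thus ?thesis by (simp add: edges_between_def)
    qed
    have "\<bar>real (edges_between ?E {0} {1})
          - (\<Sum>i<m. \<Sum>j<m. density ?E (P i) (P j) * real (card ({0} \<inter> P i)) * real (card ({1} \<inter> P j)))\<bar>
        \<le> \<alpha> * (real (card ?V))\<^sup>2"
      using wr unfolding weak_regular_def by blast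
    hence "\<bar>1 - density ?E ?V ?V\<bar> \<le> \<alpha> * 4" using e1 by (simp add: m1 PV)
    thus False using \<alpha> e2 by (simp add: density_def)
  qed
qed

text \<open>A weighted count of the cube points near one vector \<open>\<phi>\<close>. The sum
  factors over the coordinates, and each contributes at most \<open>1 + exp (-1)\<close>.\<close>

lemma sum_exp_hypercube_le:
  fixes \<phi> :: "nat \<Rightarrow> real"
  assumes D: "finite D"
  shows "(\<Sum>S\<in>Pow D. exp (- (\<Sum>l\<in>D. \<bar>of_bool (l \<in> S) - \<phi> l\<bar>))) \<le> (1 + exp (-1)) ^ card D"
proof -
  have one: "exp (- \<bar>1 - x\<bar>) + exp (- \<bar>x\<bar>) \<le> 1 + exp (-1)" for x :: real
  proof -
    \<comment> \<open>Clamping to \<open>[0, 1]\<close> moves \<open>x\<close> no further from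
      \<open>0\<close> or from \<open>1\<close>. Then \<open>(1 - u) * (1 - v) \<ge> 0\<close> for
      the two exponentials \<open>u\<close> and \<open>v\<close>, whose product is
      \<open>exp (-1)\<close>.\<close>
    define y where "y = max 0 (min 1 x)"
    have y: "0 \<le> y" "y \<le> 1" "\<bar>1 - y\<bar> \<le> \<bar>1 - x\<bar>" "\<bar>y\<bar> \<le> \<bar>x\<bar>" by (auto simp: y_def)
    have "exp (- \<bar>1 - x\<bar>) + exp (- \<bar>x\<bar>) \<le> exp (- (1 - y)) + exp (- y)"
      using y by (intro add_mono) auto
    also have "\<dots> \<le> 1 + exp (- (1 - y)) * exp (- y)"
    proof -
      have "0 \<le> (1 - exp (- (1 - y))) * (1 - exp (- y))" using y by (intro mult_nonneg_nonneg) auto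
      thus ?thesis by (simp add: algebra_simps)
    qed
    also have "exp (- (1 - y)) * exp (- y) = exp (-1)" by (simp add: mult_exp_exp)
    finally show ?thesis .
  qed
  have "exp (- (\<Sum>l\<in>D. \<bar>of_bool (l \<in> S) - \<phi> l\<bar>))
      = (\<Prod>l\<in>S. exp (- \<bar>1 - \<phi> l\<bar>)) * (\<Prod>l\<in>D - S. exp (- \<bar>\<phi> l\<bar>))" if S: "S \<in> Pow D" for S
  proof -
    have "exp (- (\<Sum>l\<in>D. \<bar>of_bool (l \<in> S) - \<phi> l\<bar>)) = (\<Prod>l\<in>D. exp (- \<bar>of_bool (l \<in> S) - \<phi> l\<bar>))"
      using D by (simp add: exp_sum sum_negf[symmetric])
    also have "\<dots> = (\<Prod>l\<in>D - S. exp (- \<bar>of_bool (l \<in> S) - \<phi> l\<bar>)) * (\<Prod>l\<in>S. exp (- \<bar>of_bool (l \<in> S) - \<phi> l\<bar>))"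
      using S D by (intro prod.subset_diff) auto
    finally show ?thesis by (simp add: mult.commute)
  qed
  hence "(\<Sum>S\<in>Pow D. exp (- (\<Sum>l\<in>D. \<bar>of_bool (l \<in> S) - \<phi> l\<bar>)))
      = (\<Sum>S\<in>Pow D. (\<Prod>l\<in>S. exp (- \<bar>1 - \<phi> l\<bar>)) * (\<Prod>l\<in>D - S. exp (- \<bar>\<phi> l\<bar>)))"
    by (rule sum.cong[OF refl])
  also have "\<dots> = (\<Prod>l\<in>D. exp (- \<bar>1 - \<phi> l\<bar>) + exp (- \<bar>\<phi> l\<bar>))" by (rule prod_add[OF D, symmetric])
  also have "\<dots> \<le> (\<Prod>l\<in>D. 1 + exp (-1))" by (intro prod_mono conjI one) (simp add: add_nonneg_nonneg)
  finally show ?thesis by simp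
qed

text \<open>Jensen's inequality, by the tangent \<open>exp u \<ge> 1 + u\<close> taken at the bound
  \<open>\<mu>\<close> for the mean.\<close>

lemma exp_average_le:
  fixes Y :: "'b \<Rightarrow> real"
  assumes "(\<Sum>v\<in>X. Y v) \<le> real (card X) * \<mu>"
  shows "real (card X) * exp (- \<mu>) \<le> (\<Sum>v\<in>X. exp (- Y v))"
proof -
  have "real (card X) * exp (- \<mu>) \<le> exp (- \<mu>) * (\<Sum>v\<in>X. 1 + (\<mu> - Y v))"
  proof -
    have "real (card X) * 1 \<le> (\<Sum>v\<in>X. 1 + (\<mu> - Y v))"
      using assms by (simp add: sum.distrib sum_subtractf)
    thus ?thesis by (simp add: mult.commute)
  qed
  also have "\<dots> \<le> exp (- \<mu>) * (\<Sum>v\<in>X. exp (\<mu> - Y v))"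
    by (intro mult_left_mono sum_mono exp_ge_add_one_self) auto
  also have "\<dots> = (\<Sum>v\<in>X. exp (- Y v))"
    by (simp add: sum_distrib_left mult_exp_exp)
  finally show ?thesis .
qed

text \<open>Per four coordinates: \<open>1 + exp (-1) \<le> 7/5\<close> and
  \<open>2 * (7/5) ^ 4 < 8 \<le> 16 * exp (- 1/2)\<close>. This lets a cube of dimension
  \<open>4 * e\<close> force \<open>2 ^ e\<close> parts.\<close>

lemma two_power_le_ratio:
  "(2 :: real) ^ e * (1 + exp (-1)) ^ (4 * e) \<le> 2 ^ (4 * e) * exp (- (real (4 * e) / 8))"
proof -
  have "(5/2 :: real) \<le> exp 1" using exp_lower_Taylor_quadratic[of 1] by simp
  hence a: "1 + exp (-1) \<le> (7/5 :: real)" by (simp add: exp_minus field_simps)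
  have "(1 / 2 :: real) \<le> exp (- (1/2))" using exp_ge_add_one_self[of "- (1/2) :: real"] by simp
  have "(2 :: real) * (1 + exp (-1)) ^ 4 \<le> 2 * (7/5) ^ 4"
    using a by (intro mult_left_mono power_mono) (auto simp: add_nonneg_nonneg)
  also have "\<dots> \<le> 2 ^ 4 * (1/2)" by (simp add: power_numeral_reduce)
  also have "\<dots> \<le> 2 ^ 4 * exp (- (1/2))" using \<open>(1 / 2 :: real) \<le> exp (- (1/2))\<close> by simp
  finally have "(2 * (1 + exp (-1)) ^ 4) ^ e \<le> (2 ^ 4 * exp (- (1/2) :: real)) ^ e"
    by (intro power_mono) (auto simp: add_nonneg_nonneg)
  thus ?thesis by (simp add: power_mult_distrib power_mult exp_of_nat_mult[symmetric])
qed

lemma sum_abs_le_if_subset_sums_le: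
  fixes d :: "'b \<Rightarrow> real"
  assumes X: "finite X" and le: "\<And>A. A \<subseteq> X \<Longrightarrow> \<bar>\<Sum>v\<in>A. d v\<bar> \<le> b"
  shows "(\<Sum>v\<in>X. \<bar>d v\<bar>) \<le> 2 * b"
proof -
  have "(\<Sum>v\<in>X. \<bar>d v\<bar>) = (\<Sum>v\<in>{v\<in>X. 0 \<le> d v}. \<bar>d v\<bar>) + (\<Sum>v\<in>X - {v\<in>X. 0 \<le> d v}. \<bar>d v\<bar>)"
    using X by (subst sum.subset_diff[of "{v\<in>X. 0 \<le> d v}"]) auto
  also have "(\<Sum>v\<in>{v\<in>X. 0 \<le> d v}. \<bar>d v\<bar>) = (\<Sum>v\<in>{v\<in>X. 0 \<le> d v}. d v)"
    by (intro sum.cong) auto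
  also have "(\<Sum>v\<in>X - {v\<in>X. 0 \<le> d v}. \<bar>d v\<bar>) = - (\<Sum>v\<in>X - {v\<in>X. 0 \<le> d v}. d v)"
    unfolding sum_negf[symmetric] by (intro sum.cong) auto
  also have "(\<Sum>v\<in>{v\<in>X. 0 \<le> d v}. d v) \<le> b" using le[of "{v\<in>X. 0 \<le> d v}"] by auto
  also have "- (\<Sum>v\<in>X - {v\<in>X. 0 \<le> d v}. d v) \<le> b" using le[of "X - {v\<in>X. 0 \<le> d v}"] by auto
  finally show ?thesis by simp
qed

text \<open>
  The bipartite graph joins a point of the \<open>d\<close>-dimensional cube to the members of its set of
  ones, each coordinate being blown up so that both sides have about \<open>2 ^ d\<close> vertices. On a part
  of a weakly regular partition the neighbourhoods are approximated by one vector \<open>\<phi>\<close>, and few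
  points of the cube are \<open>\<ell>\<^sub>1\<close>-close to any given vector.
\<close>

lemma weak_regularity_bound_exponential:
  assumes k: "weak_regularity_bound k" and e: "1 \<le> e" and \<alpha>: "0 < \<alpha>" "\<alpha> * (512 * real e) \<le> 1"
  shows "2 ^ e \<le> k \<alpha>"
proof -
  define d where "d = 4 * e"
  define N where "N = (2 :: nat) ^ d"
  \<comment> \<open>The blow-up size of a coordinate. As \<open>d \<le> N\<close>, all blown-up
    coordinates together have between \<open>N / 2\<close> and \<open>N\<close> vertices.\<close>
  define c where "c = N div d"
  define Y where "Y l = {N + l * c..<N + l * c + c}" for l
  define V where "V = {..<N + d * c}"
  have d0: "0 < d" using e by (simp add: d_def)
  have dN: "d \<le> N" unfolding N_def by (rule less_imp_le[OF less_exp])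
  have cN: "d * c \<le> N" by (simp add: c_def)
  have cardV: "real (card V) \<le> 2 * real N"
  proof -
    have "card V \<le> 2 * N" using cN by (simp add: V_def)
    thus ?thesis by linarith
  qed
  have c1: "1 \<le> c" unfolding c_def using dN d0 by (simp add: Suc_leI div_greater_zero_iff)
  have Nc: "real N \<le> 2 * real d * real c"
  proof -
    have "N = d * c + N mod d" "N mod d < d" "d \<le> d * c" using d0 c1 by (simp_all add: c_def)
    hence "N \<le> 2 * d * c" by linarith
    thus ?thesis by (metis of_nat_le_iff of_nat_mult of_nat_numeral)
  qed
  have Nd: "N = card (Pow {..<d})" by (simp add: N_def card_Pow)
  obtain S where S: "bij_betw S {..<N} (Pow {..<d})"
    using ex_bij_betw_nat_finite[of "Pow {..<d}"] unfolding Nd by (auto simp: lessThan_atLeast0)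
  have Yv: "l = l'" if "y \<in> Y l" "y \<in> Y l'" for y l l'
  proof (rule ccontr)
    assume "l \<noteq> l'"
    hence "Suc l \<le> l' \<or> Suc l' \<le> l" by linarith
    hence "Suc l * c \<le> l' * c \<or> Suc l' * c \<le> l * c" by (meson mult_le_mono1)
    thus False using that by (auto simp: Y_def)
  qed
  have YV: "Y l \<subseteq> V" if "l < d" for l
  proof -
    have "Suc l * c \<le> d * c" using that by (intro mult_right_mono) auto
    thus ?thesis by (auto simp: Y_def V_def)
  qed
  have YN: "N \<le> y" if "y \<in> Y l" for y l using that by (auto simp: Y_def)
  define E where "E = {{v, y} | v y l. v < N \<and> l < d \<and> l \<in> S v \<and> y \<in> Y l}"
  have E_iff: "{x, y} \<in> E \<longleftrightarrow> l \<in> S x" if xy: "x < N" "y \<in> Y l" "l < d" for x y l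
  proof
    assume "{x, y} \<in> E"
    then obtain v y' l' where v: "{x, y} = {v, y'}" "v < N" "l' \<in> S v" "y' \<in> Y l'"
      unfolding E_def by blast
    have "x = v \<and> y = y'" using v(1,2) xy YN[OF v(4)] YN[OF xy(2)] by (auto simp: doubleton_eq_iff)
    thus "l \<in> S x" using v(3,4) xy(2) Yv[of y l l'] by auto
  qed (use xy in \<open>auto simp: E_def\<close>)
  have "fin_graph V E"
    unfolding fin_graph_def
  proof (intro conjI ballI)
    fix a assume "a \<in> E"
    then obtain v y l where v: "a = {v, y}" "v < N" "l < d" "y \<in> Y l" unfolding E_def by blast
    have "v \<in> V" "y \<in> V" "v \<noteq> y" using v YV[OF v(3)] YN[OF v(4)] by (auto simp: V_def)
    thus "\<exists>u\<in>V. \<exists>w\<in>V. u \<noteq> w \<and> a = {u, w}" using v(1) by blast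
  qed (simp add: V_def)
  then obtain m P where m: "m \<le> k \<alpha>" and P: "equitable_partition V m P" and wr: "weak_regular \<alpha> V E m P"
    using k \<alpha> unfolding weak_regularity_bound_def by blast
  have disj: "disjoint_family_on P {..<m}" and U: "(\<Union>i<m. P i) = V"
    using P by (simp_all add: equitable_partition_def)
  have XV: "{..<N} \<subseteq> V" by (auto simp: V_def)
  have "\<forall>v\<in>V. \<exists>i. i < m \<and> v \<in> P i" using U by blast
  from bchoice[OF this] obtain part where part: "\<And>v. v \<in> V \<Longrightarrow> part v < m \<and> v \<in> P (part v)" by blast
  have part_eq: "v \<in> P i \<longleftrightarrow> part v = i" if "v \<in> V" "i < m" for v i
    using part[OF that(1)] that(2) disj by (auto simp: disjoint_family_on_def)
  \<comment> \<open>The density into \<open>Y l\<close> that the partition predicts for a vertex of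
    part \<open>i\<close>.\<close>
  define \<phi> where "\<phi> l i = (\<Sum>j<m. density E (P i) (P j) * real (card (Y l \<inter> P j))) / real c" for l i
  have \<phi>c: "\<phi> l i * real c = (\<Sum>j<m. density E (P i) (P j) * real (card (Y l \<inter> P j)))" for l i
    using c1 by (simp add: \<phi>_def)
  define D where "D l v = of_bool (l \<in> S v) - \<phi> l (part v)" for l v
  \<comment> \<open>Weak regularity for the pair \<open>(A, Y l)\<close>. As \<open>A\<close> is
    free, \<open>sum_abs_le_if_subset_sums_le\<close> bounds the absolute deviations.\<close>
  have Db: "\<bar>\<Sum>v\<in>A. D l v\<bar> \<le> \<alpha> * (real (card V))\<^sup>2 / real c" if l: "l < d" and A: "A \<subseteq> {..<N}" for l A
  proof -
    have Af: "finite A" using A finite_subset by blast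
    have AV: "A \<subseteq> V" using A XV by blast
    have "{(x, y) \<in> A \<times> Y l. {x, y} \<in> E} = {v\<in>A. l \<in> S v} \<times> Y l"
      using A E_iff[OF _ _ l] by fastforce
    hence "real (edges_between E A (Y l)) = (\<Sum>v\<in>A. of_bool (l \<in> S v)) * real c"
      using Af by (simp add: edges_between_def card_cartesian_product sum_of_bool_eq Int_def Y_def)
    moreover have "(\<Sum>i<m. \<Sum>j<m. density E (P i) (P j) * real (card (A \<inter> P i)) * real (card (Y l \<inter> P j)))
       = (\<Sum>v\<in>A. \<phi> l (part v)) * real c"
    proof -
      have "(\<Sum>i<m. \<Sum>j<m. density E (P i) (P j) * real (card (A \<inter> P i)) * real (card (Y l \<inter> P j)))
         = (\<Sum>i<m. real (card (A \<inter> P i)) * (\<phi> l i * real c))"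
        unfolding \<phi>c by (intro sum.cong refl) (simp add: sum_distrib_left mult_ac)
      also have "\<dots> = (\<Sum>i<m. real (card (A \<inter> P i)) * \<phi> l i) * real c"
        by (simp add: sum_distrib_right mult.assoc)
      also have "(\<Sum>i<m. real (card (A \<inter> P i)) * \<phi> l i) = (\<Sum>i<m. \<Sum>v\<in>{v\<in>A. part v = i}. \<phi> l (part v))"
      proof (intro sum.cong refl)
        fix i assume i: "i \<in> {..<m}"
        have "A \<inter> P i = {v\<in>A. part v = i}" using part_eq AV i by blast
        thus "real (card (A \<inter> P i)) * \<phi> l i = (\<Sum>v\<in>{v\<in>A. part v = i}. \<phi> l (part v))" by simp
      qed
      also have "\<dots> = (\<Sum>v\<in>A. \<phi> l (part v))"
        using Af AV part by (intro sum.group) auto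
      finally show ?thesis .
    qed
    moreover have "\<bar>real (edges_between E A (Y l))
        - (\<Sum>i<m. \<Sum>j<m. density E (P i) (P j) * real (card (A \<inter> P i)) * real (card (Y l \<inter> P j)))\<bar>
      \<le> \<alpha> * (real (card V))\<^sup>2"
      using wr AV YV[OF l] unfolding weak_regular_def by blast
    ultimately have "\<bar>(\<Sum>v\<in>A. D l v) * real c\<bar> \<le> \<alpha> * (real (card V))\<^sup>2"
      by (simp add: D_def sum_subtractf left_diff_distrib)
    thus ?thesis using c1 by (simp add: abs_mult le_divide_eq)
  qed
  have "(\<Sum>v<N. \<Sum>l<d. \<bar>D l v\<bar>) = (\<Sum>l<d. \<Sum>v<N. \<bar>D l v\<bar>)" by (rule sum.swap)
  also have "\<dots> \<le> (\<Sum>l<d. 2 * (\<alpha> * (real (card V))\<^sup>2 / real c))"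
    using Db by (intro sum_mono sum_abs_le_if_subset_sums_le) auto
  also have "\<dots> = 2 * real d * \<alpha> * (real (card V))\<^sup>2 / real c" by simp
  also have "\<dots> \<le> 2 * real d * \<alpha> * (2 * real N)\<^sup>2 / real c"
    using cardV \<alpha> by (intro divide_right_mono mult_left_mono power_mono) auto
  also have "\<dots> = real N * (8 * real d * \<alpha> * (real N / real c))"
    by (simp add: power2_eq_square)
  also have "\<dots> \<le> real N * (8 * real d * \<alpha> * (2 * real d))"
    using Nc c1 \<alpha> by (intro mult_left_mono) (auto simp: divide_le_eq)
  \<comment> \<open>With \<open>d = 4 * e\<close> the factor
    \<open>16 * d\<^sup>2 * \<alpha>\<close> is \<open>512 * e * \<alpha>\<close> times
    \<open>d / 8\<close>: the source of the constant 512.\<close>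
  also have "\<dots> = real N * (\<alpha> * (512 * real e) * (real d / 8))" by (simp add: d_def)
  also have "\<dots> \<le> real N * (1 * (real d / 8))"
    using \<alpha> by (intro mult_left_mono mult_right_mono) auto
  finally have avg: "(\<Sum>v<N. \<Sum>l<d. \<bar>D l v\<bar>) \<le> real (card {..<N}) * (real d / 8)" by simp
  have "real N * exp (- (real d / 8)) \<le> (\<Sum>v<N. exp (- (\<Sum>l<d. \<bar>D l v\<bar>)))"
    using exp_average_le[OF avg] by simp
  \<comment> \<open>Each cube point is charged to all \<open>m\<close> vectors, not just to that of
    its own part, so that the cube estimate applies to every \<open>i\<close> separately.\<close>
  also have "\<dots> \<le> (\<Sum>v<N. \<Sum>i<m. exp (- (\<Sum>l<d. \<bar>of_bool (l \<in> S v) - \<phi> l i\<bar>)))"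
  proof (intro sum_mono)
    fix v assume "v \<in> {..<N}"
    hence "part v \<in> {..<m}" using part XV by auto
    thus "exp (- (\<Sum>l<d. \<bar>D l v\<bar>)) \<le> (\<Sum>i<m. exp (- (\<Sum>l<d. \<bar>of_bool (l \<in> S v) - \<phi> l i\<bar>)))"
      unfolding D_def by (intro member_le_sum[of "part v"]) auto
  qed
  also have "\<dots> = (\<Sum>i<m. \<Sum>v<N. exp (- (\<Sum>l<d. \<bar>of_bool (l \<in> S v) - \<phi> l i\<bar>)))" by (rule sum.swap)
  also have "\<dots> \<le> (\<Sum>i<m. (1 + exp (-1)) ^ d)"
  proof (intro sum_mono)
    fix i
    have "(\<Sum>v<N. exp (- (\<Sum>l<d. \<bar>of_bool (l \<in> S v) - \<phi> l i\<bar>)))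
        = (\<Sum>T\<in>Pow {..<d}. exp (- (\<Sum>l<d. \<bar>of_bool (l \<in> T) - \<phi> l i\<bar>)))"
      by (rule sum.reindex_bij_betw[OF S])
    also have "\<dots> \<le> (1 + exp (-1)) ^ card {..<d}" by (rule sum_exp_hypercube_le) simp
    finally show "(\<Sum>v<N. exp (- (\<Sum>l<d. \<bar>of_bool (l \<in> S v) - \<phi> l i\<bar>))) \<le> (1 + exp (-1)) ^ d" by simp
  qed
  finally have "real N * exp (- (real d / 8)) \<le> real m * (1 + exp (-1)) ^ d" by simp
  moreover have "2 ^ e * (1 + exp (-1)) ^ d \<le> real N * exp (- (real d / 8))"
    unfolding N_def d_def using two_power_le_ratio[of e] by simp
  ultimately have "2 ^ e * (1 + exp (-1)) ^ d \<le> real m * (1 + exp (-1) :: real) ^ d" by linarith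
  hence "2 ^ e \<le> real m" by (rule mult_right_le_imp_le) (simp add: add_pos_pos)
  hence "2 ^ e \<le> m" by (metis of_nat_le_iff of_nat_power of_nat_numeral)
  thus ?thesis using m by linarith
qed

subsection \<open>Regular approximation\<close>

text \<open>Singletons, padded by empty parts up to \<open>s\<close>. In a part with at most one
  vertex a subset of the required size is the whole part, since \<open>g\<close> is
  positive.\<close>

lemma small_graph_regular_partition:
  fixes V :: "'a set"
  assumes V: "finite V" and g: "\<And>x. 0 < g x"
  obtains P where "equitable_partition V (max (card V) s) P"
    "g_regular_partition g E (max (card V) s) P"
proof -
  obtain e where e: "bij_betw e {..<card V} V"
    using ex_bij_betw_nat_finite[OF V] by (auto simp: lessThan_atLeast0)
  define P where "P i = (if i < card V then {e i} else {})" for i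
  have Pcard: "card (P i) \<le> 1" "finite (P i)" for i by (simp_all add: P_def)
  have "equitable_partition V (max (card V) s) P"
    unfolding equitable_partition_def
  proof (intro conjI allI impI)
    show "disjoint_family_on P {..<max (card V) s}"
      using bij_betw_imp_inj_on[OF e] by (auto simp: disjoint_family_on_def P_def inj_on_def)
    have "(\<Union>i<max (card V) s. P i) = (\<Union>i\<in>{..<card V}. {e i})"
    proof (intro equalityI UN_least)
      fix i
      show "P i \<subseteq> (\<Union>i\<in>{..<card V}. {e i})" by (auto simp: P_def)
      assume "i \<in> {..<card V}"
      thus "{e i} \<subseteq> (\<Union>i<max (card V) s. P i)" 
        by (intro subset_trans[OF _ UN_upper[of i]]) (auto simp: P_def)
    qed
    hence "(\<Union>i<max (card V) s. P i) = e ` {..<card V}" by auto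
    thus "(\<Union>i<max (card V) s. P i) = V" using bij_betw_imp_surj_on[OF e] by simp
    show "card (P i) \<le> card (P j) + 1" for i j using Pcard(1)[of i] by simp
  qed
  moreover have "g_regular_partition g E (max (card V) s) P"
    unfolding g_regular_partition_def regular_pair_def
  proof (intro allI impI)
    fix i j A B
    assume AB: "A \<subseteq> P i" "B \<subseteq> P j"
      and c: "real (card A) \<ge> g (max (card V) s) * real (card (P i))"
        "real (card B) \<ge> g (max (card V) s) * real (card (P j))"
    have full: "A' = P i'" if "A' \<subseteq> P i'" "real (card A') \<ge> g (max (card V) s) * real (card (P i'))" for A' i'
    proof (cases "card (P i') = 0")
      case False
      hence "0 < g (max (card V) s) * real (card (P i'))" using g by simp
      hence "card A' \<noteq> 0" using that(2) by (cases "card A' = 0") auto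
      hence "card (P i') \<le> card A'" using Pcard(1)[of i'] by linarith
      thus ?thesis using card_seteq[OF Pcard(2) that(1)] by blast
    next
      case True
      thus ?thesis using that(1) Pcard(2)[of i'] by simp
    qed
    show "\<bar>density E A B - density E (P i) (P j)\<bar> \<le> g (max (card V) s)"
      unfolding full[OF AB(1) c(1)] full[OF AB(2) c(2)] using less_imp_le[OF g] by simp
  qed
  ultimately show ?thesis by (rule that)
qed

lemma equitable_part_card_ge:
  assumes P: "equitable_partition V m P" and a: "a < m"
  shows "card V \<le> m * (card (P a) + 1)"
proof -
  have "card V = card (\<Union>i\<in>{..<m}. P i)" using P by (simp add: equitable_partition_def)
  also have "\<dots> \<le> (\<Sum>i\<in>{..<m}. card (P i))" by (rule card_UN_le) simp
  also have "\<dots> \<le> (\<Sum>i\<in>{..<m}. card (P a) + 1)"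
    using P a by (intro sum_mono) (auto simp: equitable_partition_def)
  finally show ?thesis by simp
qed

section \<open>Growth of the sequence \<open>t\<close>\<close>

lemma linear_le_two_power:
  assumes "20 \<le> e"
  shows "1024 * e \<le> (2 :: nat) ^ (e - 2)"
  using assms
proof (induction e rule: dec_induct)
  case (step n)
  have "(2 :: nat) ^ (Suc n - 2) = 2 * 2 ^ (n - 2)"
    using step.hyps by (simp add: Suc_diff_le flip: power_Suc)
  moreover have "1024 * Suc n \<le> 2 * (1024 * n)" using step.hyps by simp
  ultimately show ?case using step.IH by linarith
qed simp

text \<open>
  The sequence \<open>t\<close> grows so fast that twelve of its steps pay for one refinement step: ten
  doublings bring \<open>1 / \<delta>\<close> into the range where the exponential lower bound for \<open>k\<close> is effective,
  and two more applications of it suffice.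
\<close>

lemma bound_sequence_growth:
  fixes t :: "nat \<Rightarrow> nat" and \<delta> :: "nat \<Rightarrow> real"
  assumes k: "weak_regularity_bound k"
    and \<delta>0: "\<And>x. 1 \<le> x \<Longrightarrow> 0 < \<delta> x" and \<delta>32: "\<And>x. 1 \<le> x \<Longrightarrow> \<delta> x * (32 * (real x)\<^sup>2) \<le> 1"
    and \<delta>mono: "\<And>x y. 1 \<le> x \<Longrightarrow> x \<le> y \<Longrightarrow> \<delta> y \<le> \<delta> x"
    and t1: "1 \<le> t 1" and tS: "\<And>i. 1 \<le> i \<Longrightarrow> t (i + 1) = t i * k (\<delta> (t i))"
    and i: "1 \<le> i"
  shows "2 ^ r * t i \<le> t (i + r)"
    and "real (t i) * 2 powr ((1 / \<delta> (t i))\<^sup>2 / 2) * (1 / \<delta> (t i))\<^sup>2 \<le> real (t (i + 12))"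
proof -
  have \<delta>le: "\<delta> x \<le> 1 / 32" if "1 \<le> x" for x
  proof -
    have "\<delta> x * 32 \<le> \<delta> x * (32 * (real x)\<^sup>2)"
      using that \<delta>0[OF that] by (intro mult_left_mono) (auto simp: one_le_power)
    thus ?thesis using \<delta>32[OF that] by simp
  qed
  have tpos: "1 \<le> t i" if "1 \<le> i" for i
    using that
  proof (induction i rule: dec_induct)
    case (step n)
    have "2 \<le> k (\<delta> (t n))" by (rule weak_regularity_bound_ge_2[OF k \<delta>0 \<delta>le]) (rule step.IH)+
    hence "1 * 1 \<le> t n * k (\<delta> (t n))" using step.IH by (intro mult_mono) auto
    thus ?case using tS[of n] step.hyps by simp
  qed (rule t1)
  have double: "2 ^ r * t i \<le> t (i + r)" if i: "1 \<le> i" for i r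
  proof (induction r)
    case (Suc r)
    have ir: "1 \<le> i + r" using i by simp
    have "2 \<le> k (\<delta> (t (i + r)))"
      by (rule weak_regularity_bound_ge_2[OF k \<delta>0 \<delta>le]) (rule tpos[OF ir])+
    hence "t (i + r) * 2 \<le> t (i + r) * k (\<delta> (t (i + r)))" by (rule mult_left_mono) simp
    also have "\<dots> = t (i + Suc r)" using tS[OF ir] by simp
    finally show ?case using Suc by simp
  qed simp
  show "2 ^ r * t i \<le> t (i + r)" by (rule double[OF i])
  have big: "2 ^ e \<le> t (i + 1)" if i: "1 \<le> i" and e: "1 \<le> e" "512 * real e \<le> 1 / \<delta> (t i)" for i e
  proof -
    have "\<delta> (t i) * (512 * real e) \<le> 1"
      using e \<delta>0[OF tpos[OF i]] by (simp add: le_divide_eq mult.commute)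
    hence "2 ^ e \<le> k (\<delta> (t i))"
      by (intro weak_regularity_bound_exponential[OF k e(1)] \<delta>0 tpos i)
    also have "\<dots> \<le> t i * k (\<delta> (t i))" using tpos[OF i] by simp
    finally show ?thesis using tS[OF i] by simp
  qed
  have y32: "32 * (real (t i))\<^sup>2 \<le> 1 / \<delta> (t i)" if "1 \<le> i" for i
    using \<delta>32[OF tpos[OF that]] \<delta>0[OF tpos[OF that]] by (simp add: le_divide_eq mult.commute)
  define y where "y = 1 / \<delta> (t i)"
  define y' where "y' = 1 / \<delta> (t (i + 10))"
  have i': "1 \<le> i + 10" "1 \<le> i + 11" using i by simp_all
  have ti10: "1024 * t i \<le> t (i + 10)" using double[OF i, of 10] by simp
  have yy': "y \<le> y'"
    unfolding y_def y'_def
    using \<delta>0[OF tpos[OF i'(1)]] \<delta>mono[OF tpos[OF i], of "t (i + 10)"] ti10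
    by (intro divide_left_mono mult_pos_pos \<delta>0 tpos i i') auto
  \<comment> \<open>\<open>33554432 = 32 * 1024\<^sup>2\<close>, where 1024 comes from the ten
    doublings.\<close>
  have y'big: "33554432 \<le> y'"
  proof -
    have "1024 \<le> t (i + 10)" using ti10 tpos[OF i] by linarith
    hence "(1024 :: real)\<^sup>2 \<le> (real (t (i + 10)))\<^sup>2" by (intro power_mono) auto
    hence "33554432 \<le> 32 * (real (t (i + 10)))\<^sup>2" by simp
    thus ?thesis using y32[OF i'(1)] unfolding y'_def by linarith
  qed
  \<comment> \<open>The largest exponent to which the exponential lower bound applies at index
    \<open>i + 10\<close>.\<close>
  define e where "e = nat \<lfloor>y' / 512\<rfloor>"
  have e: "real e \<le> y' / 512" "y' / 512 < real e + 1"
  proof -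
    have "real e = of_int \<lfloor>y' / 512\<rfloor>" using y'big by (simp add: e_def)
    thus "real e \<le> y' / 512" "y' / 512 < real e + 1" by linarith+
  qed
  have e20: "20 \<le> e" using e(2) y'big by linarith
  have "2 ^ e \<le> t (i + 10 + 1)"
    using e e20 by (intro big[OF i'(1)]) (auto simp: y'_def)
  moreover have "i + 10 + 1 = i + 11" by simp
  ultimately have t11: "2 ^ e \<le> t (i + 11)" by (simp only:)
  have "real (2 ^ e) \<le> real (t (i + 11))" using t11 by (simp only: of_nat_le_iff)
  hence "(2 ^ e)\<^sup>2 \<le> (real (t (i + 11)))\<^sup>2" by (intro power_mono) auto
  hence "32 * (2 ^ e)\<^sup>2 \<le> 1 / \<delta> (t (i + 11))" using y32[OF i'(2)] by linarith
  \<comment> \<open>Second application, at index \<open>i + 11\<close>: since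
    \<open>1 / \<delta> (t (i + 11))\<close> is at least \<open>32 * (2 ^ e)\<^sup>2\<close>, the
    exponent may be \<open>(2 ^ (e - 2))\<^sup>2\<close>.\<close>
  moreover have "512 * real (((2 :: nat) ^ (e - 2))\<^sup>2) = 32 * (2 ^ e)\<^sup>2"
  proof -
    have "(2 :: real) ^ e = 4 * 2 ^ (e - 2)"
    proof -
      have "(2 :: real) ^ e = 2 ^ (2 + (e - 2))"
        by (rule arg_cong[where f = "(^) 2"]) (use e20 in simp)
      thus ?thesis unfolding power_add by simp
    qed
    thus ?thesis by (simp add: power_mult_distrib)
  qed
  ultimately have "2 ^ (((2 :: nat) ^ (e - 2))\<^sup>2) \<le> t (i + 11 + 1)"
    by (intro big[OF i'(2)]) auto
  moreover have "i + 11 + 1 = i + 12" by simp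
  ultimately have t12: "(2 :: nat) ^ ((2 ^ (e - 2))\<^sup>2) \<le> t (i + 12)" by (simp only:)
  have y32': "32 \<le> y" unfolding y_def using \<delta>le[OF tpos[OF i]] \<delta>0[OF tpos[OF i]]
    by (simp add: le_divide_eq)
  have ty: "real (t i) \<le> y"
  proof -
    have "real (t i) * 1 \<le> real (t i) * real (t i)" using tpos[OF i] by (intro mult_left_mono) auto
    thus ?thesis using y32[OF i] unfolding y_def by (simp add: power2_eq_square)
  qed
  have y2: "y \<le> 2 powr (y + 1)"
  proof -
    have "y \<le> real (nat \<lceil>y\<rceil>)" by linarith
    also have "\<dots> \<le> real (2 ^ nat \<lceil>y\<rceil>)" using less_exp[of "nat \<lceil>y\<rceil>"] by (simp only: of_nat_le_iff)
    also have "\<dots> = 2 powr (real (nat \<lceil>y\<rceil>))" by (simp add: powr_realpow)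
    also have "\<dots> \<le> 2 powr (y + 1)" using y32' by (intro powr_mono) linarith+
    finally show ?thesis .
  qed
  \<comment> \<open>Polynomial factors are absorbed:
    \<open>t i * y\<^sup>2 \<le> y ^ 3 \<le> 2 powr (3 * (y + 1))\<close>, and the exponents satisfy
    \<open>y\<^sup>2 / 2 + 3 * (y + 1) \<le> y\<^sup>2 \<le> (1024 * e)\<^sup>2\<close>.\<close>
  have "real (t i) * 2 powr (y\<^sup>2 / 2) * y\<^sup>2 \<le> y * 2 powr (y\<^sup>2 / 2) * y\<^sup>2"
    using ty by (intro mult_right_mono) auto
  also have "\<dots> = 2 powr (y\<^sup>2 / 2) * y ^ 3" by (simp add: power2_eq_square power3_eq_cube)
  also have "\<dots> \<le> 2 powr (y\<^sup>2 / 2) * (2 powr (y + 1)) ^ 3"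
    using y2 y32' by (intro mult_left_mono power_mono) auto
  also have "\<dots> = 2 powr (y\<^sup>2 / 2 + 3 * (y + 1))"
    by (simp add: powr_add powr_realpow[symmetric] powr_powr mult.commute)
  also have "\<dots> \<le> 2 powr (real ((1024 * e)\<^sup>2))"
  proof (rule powr_mono)
    have "32 * y \<le> y\<^sup>2" using y32' by (simp add: power2_eq_square)
    moreover have "3 * (y + 1) \<le> Y / 2" if "32 * y \<le> Y" for Y
    proof -
      have "6 \<le> 26 * y" using y32' by simp
      thus ?thesis using that by (simp add: field_simps)
    qed
    ultimately have "3 * (y + 1) \<le> y\<^sup>2 / 2" by blast
    moreover have "y\<^sup>2 \<le> (real (1024 * e))\<^sup>2"
    proof (rule power_mono)
      have "512 * real e + 512 \<le> 1024 * real e" using e20 by simp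
      thus "y \<le> real (1024 * e)" using yy' e(2) by simp
    qed (use y32' in simp)
    ultimately show "y\<^sup>2 / 2 + 3 * (y + 1) \<le> real ((1024 * e)\<^sup>2)" by simp
  qed simp
  also have "\<dots> \<le> 2 powr (real ((2 ^ (e - 2))\<^sup>2))"
  proof (rule powr_mono)
    have "(1024 * e)\<^sup>2 \<le> (2 ^ (e - 2))\<^sup>2" using linear_le_two_power[OF e20] by (intro power_mono) auto
    thus "real ((1024 * e)\<^sup>2) \<le> real ((2 ^ (e - 2))\<^sup>2)" by (simp only: of_nat_le_iff)
  qed simp
  also have "\<dots> = real (2 ^ ((2 ^ (e - 2))\<^sup>2))" by (subst powr_realpow) simp_all
  also have "\<dots> \<le> real (t (i + 12))" using t12 by (simp only: of_nat_le_iff)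
  finally show "real (t i) * 2 powr ((1 / \<delta> (t i))\<^sup>2 / 2) * (1 / \<delta> (t i))\<^sup>2 \<le> real (t (i + 12))"
    unfolding y_def .
qed

theorem theorem1p12:
  fixes \<epsilon> T :: real and s T\<^sub>0 j n :: nat
    and g \<delta> :: "nat \<Rightarrow> real" and k :: "real \<Rightarrow> nat" and t :: "nat \<Rightarrow> nat"
    and V :: "'a set" and E :: "'a set set"
  assumes "\<epsilon> > 0" and "s > 0"
    and "\<And>x. g x \<in> {0<..<1}" and "antimono g"
    and "weak_regularity_bound k"
    and "\<And>x. \<delta> x = min (g x ^ 3 / (32 * (real x)\<^sup>2)) (\<epsilon> / 2)"
    and "t 1 = s" and "\<And>i. i \<ge> 1 \<Longrightarrow> t (i + 1) = t i * k (\<delta> (t i))"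
    and "j = nat \<lceil>4 / \<epsilon>\<^sup>2\<rceil>" and "T\<^sub>0 = t j" and "T = 16 * real T\<^sub>0 / (\<delta> T\<^sub>0)\<^sup>2"
    and "fin_graph V E" and "card V = n"
  shows "\<exists>E' m P. fin_graph V E' \<and>
           real (card ((E - E') \<union> (E' - E))) \<le> \<epsilon> * (real n)\<^sup>2 \<and>
           s \<le> m \<and> real m \<le> T \<and>
           equitable_partition V m P \<and> g_regular_partition g E' m P"
proof -
  note \<epsilon> = assms(1) and k = assms(5) and \<delta> = assms(6) and tS = assms(8) and T = assms(11)
    and VE = assms(12) and n = assms(13)
  have V: "finite V" using VE by (simp add: fin_graph_def)
  have g: "0 < g x" "g x < 1" for x using assms(3)[of x] by simp_all
  have g3: "0 < g x ^ 3" "g x ^ 3 \<le> 1" for x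
    using g[of x] by (simp_all add: power_le_one)
  have \<delta>0: "0 < \<delta> x" if "1 \<le> x" for x
    using that g3(1)[of x] \<epsilon> by (simp add: \<delta>)
  have \<delta>g: "\<delta> x * (32 * (real x)\<^sup>2) \<le> g x ^ 3" if "1 \<le> x" for x
  proof -
    have "\<delta> x \<le> g x ^ 3 / (32 * (real x)\<^sup>2)" by (simp add: \<delta>)
    moreover have "0 < 32 * (real x)\<^sup>2" using that by simp
    ultimately show ?thesis by (simp only: le_divide_eq if_True simp_thms)
  qed
  have \<delta>32: "\<delta> x * (32 * (real x)\<^sup>2) \<le> 1" if "1 \<le> x" for x
    using \<delta>g[OF that] g3(2)[of x] by linarith
  have \<delta>\<epsilon>: "\<delta> x \<le> \<epsilon> / 2" for x by (simp add: \<delta>)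
  have \<delta>mono: "\<delta> y \<le> \<delta> x" if "1 \<le> x" "x \<le> y" for x y
  proof -
    have "g y ^ 3 \<le> g x ^ 3" using antimonoD[OF assms(4) that(2)] g(1)[of y] by (intro power_mono) auto
    moreover have "32 * (real x)\<^sup>2 \<le> 32 * (real y)\<^sup>2" using that by simp
    ultimately have "g y ^ 3 / (32 * (real y)\<^sup>2) \<le> g x ^ 3 / (32 * (real x)\<^sup>2)"
      using that g(1)[of x] by (intro frac_le) auto
    thus ?thesis unfolding \<delta> by (intro min.mono) auto
  qed
  have t1: "1 \<le> t 1" using assms(2,7) by simp
  have double: "2 ^ r * t i \<le> t (i + r)" if "1 \<le> i" for i r
    by (rule bound_sequence_growth(1)[OF k \<delta>0 \<delta>32 \<delta>mono t1 tS that])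
  have growth: "real (t i) * 2 powr ((1 / \<delta> (t i))\<^sup>2 / 2) * (1 / \<delta> (t i))\<^sup>2 \<le> real (t (i + 12))"
    if "1 \<le> i" for i
    by (rule bound_sequence_growth(2)[OF k \<delta>0 \<delta>32 \<delta>mono t1 tS that])
  have tmono: "t i \<le> t i'" if "1 \<le> i" "i \<le> i'" for i i'
  proof -
    have "t i \<le> 2 ^ (i' - i) * t i" by simp
    also have "\<dots> \<le> t (i + (i' - i))" by (rule double[OF that(1)])
    finally show ?thesis using that(2) by simp
  qed
  have ts: "s \<le> t i" if "1 \<le> i" for i using tmono[of 1 i] that assms(7) by simp
  have j1: "1 \<le> j"
    using \<epsilon> assms(9) by (simp add: Suc_le_eq)
  have T0: "1 \<le> T\<^sub>0" "s \<le> T\<^sub>0" using ts[OF j1] assms(2,10) by simp_all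
  \<comment> \<open>\<open>\<delta>\<close> decreases along \<open>t\<close>, so this rounding
    parameter is at most the error \<open>\<delta> (t a)\<close> of every stage
    \<open>a \<le> j\<close>.\<close>
  define l where "l = \<delta> T\<^sub>0"
  have l: "0 < l" "l \<le> 1 / 32"
  proof -
    show "0 < l" unfolding l_def by (rule \<delta>0[OF T0(1)])
    have "l * 32 \<le> l * (32 * (real T\<^sub>0)\<^sup>2)"
      using T0 \<open>0 < l\<close> by (intro mult_left_mono) (auto simp: one_le_power)
    thus "l \<le> 1 / 32" using \<delta>32[OF T0(1)] by (simp add: l_def)
  qed
  have l2: "l\<^sup>2 \<le> 1" using l by (simp add: power_le_one)
  have T0T: "16 * real T\<^sub>0 \<le> T"
    using l l2 unfolding T l_def[symmetric] by (simp add: le_divide_eq mult_left_le)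
  show ?thesis
  proof (cases "real n \<le> T")
    case True
    obtain P where P: "equitable_partition V (max (card V) s) P" "g_regular_partition g E (max (card V) s) P"
      by (rule small_graph_regular_partition[OF V g(1)])
    have "real s \<le> T" using T0T T0(2) by linarith
    hence "real (max (card V) s) \<le> T" using True n by (simp add: max_def)
    thus ?thesis using P VE \<epsilon> by (intro exI[of _ E] exI[of _ "max (card V) s"] exI[of _ P]) auto
  next
    case False
    define G :: "'a \<times> 'a \<Rightarrow> real" where "G z = of_bool ({fst z, snd z} \<in> E)" for z
    have G01: "G z \<in> {0..1}" for z by (simp add: G_def)
    define \<eta> where "\<eta> = 2 * real (card V) / l + l * (real (card V))\<^sup>2 / 4"
    have nT: "16 * real T\<^sub>0 \<le> real n" using False T0T by linarith
    have n4: "4 \<le> card V" using nT T0(1) n by linarith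
    have nl: "16 \<le> real n * l\<^sup>2"
    proof -
      have "16 * 1 / l\<^sup>2 \<le> T" unfolding T l_def[symmetric] using T0(1) l
        by (intro divide_right_mono mult_left_mono) auto
      hence "16 / l\<^sup>2 \<le> real n" using False by linarith
      thus ?thesis using l by (simp add: divide_le_eq)
    qed
    \<comment> \<open>\<open>n > T\<close> gives \<open>n * l\<^sup>2 \<ge> 16\<close>, under which
      the first term of \<open>\<eta>\<close> is at most \<open>l * n\<^sup>2 / 8\<close>.\<close>
    have \<eta>le: "\<eta> \<le> 3/8 * l * (real n)\<^sup>2"
    proof -
      have "2 * real n * 1 \<le> 2 * real n * (real n * l\<^sup>2 / 16)"
        using nl by (intro mult_left_mono) auto
      hence "2 * real n \<le> (l * (real n)\<^sup>2 / 8) * l" by (simp add: power2_eq_square mult_ac)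
      hence "2 * real n / l \<le> l * (real n)\<^sup>2 / 8" using l by (simp add: divide_le_eq)
      thus ?thesis unfolding \<eta>_def n by simp
    qed
    show ?thesis
    proof (rule ccontr)
      assume fail: "\<not> ?thesis"
      \<comment> \<open>With the conclusion denied, the regular alternative of the dichotomy is
        contradictory, so every stage gains energy.\<close>
      have stage: "\<exists>\<rho> r. \<rho> ` V \<subseteq> {..<t a * 4 ^ r} \<and> real r \<le> 1 / (4 * (\<delta> (t a))\<^sup>2) \<and>
          bvar V \<rho> G < bvar V \<pi> G - 2 * \<epsilon>\<^sup>2 * (real n)\<^sup>2"
        if a: "1 \<le> a" "a \<le> j" and \<pi>: "\<pi> ` V \<subseteq> {..<t a}"
          and eq: "equitable_partition V (t a) (\<lambda>i. {v\<in>V. \<pi> v = i})" for a \<pi>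
      proof -
        define M where "M = t a"
        define \<beta> where "\<beta> = \<delta> M"
        have M: "1 \<le> M" "s \<le> M" "M \<le> T\<^sub>0"
          using ts[OF a(1)] assms(2,10) tmono[OF a] by (simp_all add: M_def)
        have \<beta>: "0 < \<beta>" unfolding \<beta>_def by (rule \<delta>0[OF M(1)])
        have l\<beta>: "l \<le> \<beta>" unfolding l_def \<beta>_def by (rule \<delta>mono[OF M(1,3)])
        have l1: "l \<le> 1" using l by simp
        show ?thesis
        proof (rule regularisation_dichotomy[OF VE n4 \<pi>[folded M_def] \<beta> \<epsilon> l(1) l1 \<eta>_def, folded G_def])
          fix \<rho> r
          assume "\<rho> ` V \<subseteq> {..<M * 4 ^ r}" "real r \<le> 1 / (4 * \<beta>\<^sup>2)"
            "bvar V \<rho> G < bvar V \<pi> G - 2 * \<epsilon>\<^sup>2 * (real (card V))\<^sup>2"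
          thus ?thesis unfolding M_def \<beta>_def n by blast
        next
          fix E' c
          assume E': "fin_graph V E'"
            "real (card ((E - E') \<union> (E' - E))) \<le> 3/4 * \<epsilon> * (real (card V))\<^sup>2 + \<eta>"
            "\<And>a b A B. a \<noteq> b \<Longrightarrow> A \<subseteq> {v\<in>V. \<pi> v = a} \<Longrightarrow> B \<subseteq> {v\<in>V. \<pi> v = b} \<Longrightarrow>
              \<bar>real (edges_between E' A B) - c a b * (real (card A) * real (card B))\<bar>
                \<le> \<beta> * (real (card V))\<^sup>2 + \<eta>"
          \<comment> \<open>As \<open>l \<le> \<epsilon> / 2\<close>, the rounding share is at most
            \<open>3/16 * \<epsilon> * n\<^sup>2\<close>, which fits beside
            \<open>3/4 * \<epsilon> * n\<^sup>2\<close>.\<close>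
          have "3/8 * l * (real n)\<^sup>2 \<le> 1/4 * \<epsilon> * (real n)\<^sup>2"
            using \<delta>\<epsilon>[of "T\<^sub>0"] \<epsilon> unfolding l_def by (intro mult_right_mono) auto
          hence edit: "real (card ((E - E') \<union> (E' - E))) \<le> \<epsilon> * (real n)\<^sup>2"
            using E'(2) \<eta>le unfolding n by (simp add: algebra_simps)
          have err: "\<beta> * (real (card V))\<^sup>2 + \<eta> \<le> 2 * \<beta> * (real n)\<^sup>2"
          proof -
            have "3/8 * l * (real n)\<^sup>2 \<le> 1 * \<beta> * (real n)\<^sup>2"
              using l\<beta> l by (intro mult_right_mono mult_mono) auto
            thus ?thesis using \<eta>le unfolding n by simp
          qed
          have size: "real n \<le> 2 * real M * real (card {v\<in>V. \<pi> v = i})" if i: "i < M" for i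
          proof -
            have "card V \<le> M * (card {v\<in>V. \<pi> v = i} + 1)"
              using equitable_part_card_ge[OF eq i[unfolded M_def]] unfolding M_def .
            hence "real n \<le> real (M * (card {v\<in>V. \<pi> v = i} + 1))" unfolding n by (simp only: of_nat_le_iff)
            also have "\<dots> = real M * real (card {v\<in>V. \<pi> v = i}) + real M" by (simp add: algebra_simps)
            finally show ?thesis using nT M(3) by linarith
          qed
          have n0: "0 < real n" using n4 n by linarith
          have "g_regular_partition g E' M (\<lambda>i. {v\<in>V. \<pi> v = i})"
            unfolding g_regular_partition_def
          proof (intro allI impI)
            fix i i' assume i: "i < M" "i' < M" "i \<noteq> i'"
            let ?p = "real (card {v\<in>V. \<pi> v = i})" and ?q = "real (card {v\<in>V. \<pi> v = i'})"
            show "regular_pair (g M) E' {v\<in>V. \<pi> v = i} {v\<in>V. \<pi> v = i'}"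
            proof (rule regular_pair_if_near_constant[where c = "c i i'" and \<kappa> = "2 * \<beta> * (real n)\<^sup>2"])
              show "\<bar>real (edges_between E' A B) - c i i' * (real (card A) * real (card B))\<bar> \<le> 2 * \<beta> * (real n)\<^sup>2"
                if "A \<subseteq> {v\<in>V. \<pi> v = i}" "B \<subseteq> {v\<in>V. \<pi> v = i'}" for A B
                using E'(3)[OF i(3) that] err by linarith
              show "0 < card {v\<in>V. \<pi> v = i}" using size[OF i(1)] n0 by (intro Nat.gr0I) simp
              show "0 < card {v\<in>V. \<pi> v = i'}" using size[OF i(2)] n0 by (intro Nat.gr0I) simp
              \<comment> \<open>Every part has at least \<open>n / (2 * M)\<close> vertices; the
                resulting factor \<open>M\<^sup>2\<close> is what the denominator of
                \<open>\<delta>\<close> cancels.\<close>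
              have "(real n)\<^sup>2 \<le> (2 * real M * ?p) * (2 * real M * ?q)"
                unfolding power2_eq_square using size[OF i(1)] size[OF i(2)] by (intro mult_mono) auto
              hence "2 * \<beta> * (real n)\<^sup>2 \<le> 2 * \<beta> * ((2 * real M * ?p) * (2 * real M * ?q))"
                using \<beta> by (intro mult_left_mono) auto
              also have "\<dots> = \<beta> * (32 * (real M)\<^sup>2) * (?p * ?q / 4)" by (simp add: power2_eq_square)
              also have "\<dots> \<le> g M ^ 3 * (?p * ?q / 4)"
                unfolding \<beta>_def by (intro mult_right_mono \<delta>g M(1)) auto
              also have "\<dots> \<le> g M ^ 3 * (?p * ?q / 2)"
                using g3(1)[of M] by (intro mult_left_mono) auto
              finally show "2 * \<beta> * (real n)\<^sup>2 \<le> g M ^ 3 / 2 * (?p * ?q)" by simp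
            qed (rule g)+
          qed
          moreover have "real M \<le> T" using M(3) T0T by linarith
          ultimately have False using fail E'(1) edit M(2) eq[folded M_def] by blast
          thus ?thesis ..
        qed
      qed
      \<comment> \<open>The refinement gains \<open>2 * \<epsilon>\<^sup>2 * n\<^sup>2\<close>; the
        return to an equitable partition gives up at most half of it and advances the index by
        twelve.\<close>
      have step: "\<exists>\<pi>. \<pi> ` V \<subseteq> {..<t (1 + 12 * i)} \<and>
          equitable_partition V (t (1 + 12 * i)) (\<lambda>a. {v\<in>V. \<pi> v = a}) \<and>
          bvar V \<pi> G \<le> (real n)\<^sup>2 / 4 - real i * \<epsilon>\<^sup>2 * (real n)\<^sup>2" if "1 + 12 * i \<le> j" for i
        using that
      proof (induction i)
        case 0
        obtain \<pi> where "\<pi> ` V \<subseteq> {..<s}" "equitable_partition V s (\<lambda>a. {v\<in>V. \<pi> v = a})"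
          by (rule equitable_colouring[OF V assms(2), of "\<lambda>_. 0" 1]) auto
        thus ?case using bvar_le_quarter[OF V, of G \<pi>] G01 assms(7) n by auto
      next
        case (Suc i)
        let ?a = "1 + 12 * i"
        have a: "1 \<le> ?a" "?a \<le> j" "?a + 12 \<le> j" using Suc.prems by simp_all
        from Suc.IH[OF a(2)] obtain \<pi> where \<pi>: "\<pi> ` V \<subseteq> {..<t ?a}"
          "equitable_partition V (t ?a) (\<lambda>a. {v\<in>V. \<pi> v = a})"
          "bvar V \<pi> G \<le> (real n)\<^sup>2 / 4 - real i * \<epsilon>\<^sup>2 * (real n)\<^sup>2" by blast
        from stage[OF a(1,2) \<pi>(1,2)] obtain \<rho> r where \<rho>: "\<rho> ` V \<subseteq> {..<t ?a * 4 ^ r}"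
          and r: "real r \<le> 1 / (4 * (\<delta> (t ?a))\<^sup>2)"
          and less: "bvar V \<rho> G < bvar V \<pi> G - 2 * \<epsilon>\<^sup>2 * (real n)\<^sup>2" by blast
        define M where "M = t (?a + 12)"
        have ta: "1 \<le> t ?a" using ts[OF a(1)] assms(2) by linarith
        have M: "0 < M" "M \<le> card V"
        proof -
          show "0 < M" using ts[of "?a + 12"] assms(2) by (simp add: M_def)
          have "M \<le> T\<^sub>0" unfolding M_def assms(10) using a(3) by (intro tmono) auto
          thus "M \<le> card V" using nT n by linarith
        qed
        define y where "y = 1 / \<delta> (t ?a)"
        have y0: "0 < y" using \<delta>0[OF ta] by (simp add: y_def)
        \<comment> \<open>\<open>\<delta> \<le> \<epsilon> / 2\<close> means
          \<open>y \<ge> 2 / \<epsilon>\<close>. So the factor \<open>y\<^sup>2\<close> in the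
          growth bound supplies the \<open>4 / \<epsilon>\<^sup>2\<close> that the coarsening asks
          for.\<close>
        have y: "4 \<le> \<epsilon>\<^sup>2 * y\<^sup>2"
        proof -
          have "2 \<le> \<epsilon> * y" using \<delta>\<epsilon>[of "t ?a"] \<delta>0[OF ta] by (simp add: y_def le_divide_eq)
          hence "2\<^sup>2 \<le> (\<epsilon> * y)\<^sup>2" by (intro power_mono) auto
          thus ?thesis by (simp add: power_mult_distrib)
        qed
        have "(4 :: real) ^ r = 2 powr (2 * real r)"
        proof -
          have "(4 :: real) ^ r = 2 ^ (2 * r)" by (simp add: power_mult)
          also have "\<dots> = 2 powr (real (2 * r))" by (subst powr_realpow) simp_all
          finally show ?thesis by simp
        qed
        also have "\<dots> \<le> 2 powr (y\<^sup>2 / 2)"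
          using r by (intro powr_mono) (simp_all add: y_def power_divide)
        finally have r4: "(4 :: real) ^ r \<le> 2 powr (y\<^sup>2 / 2)" .
        have "4 * real (t ?a * 4 ^ r) = 4 * (real (t ?a) * 4 ^ r)" by simp
        also have "\<dots> \<le> 4 * (real (t ?a) * 2 powr (y\<^sup>2 / 2))"
          by (intro mult_left_mono r4) auto
        also have "\<dots> \<le> (\<epsilon>\<^sup>2 * y\<^sup>2) * (real (t ?a) * 2 powr (y\<^sup>2 / 2))"
          by (intro mult_right_mono y) auto
        also have "\<dots> = \<epsilon>\<^sup>2 * (real (t ?a) * 2 powr (y\<^sup>2 / 2) * y\<^sup>2)" by simp
        also have "\<dots> \<le> \<epsilon>\<^sup>2 * real M"
          unfolding M_def y_def by (intro mult_left_mono growth a(1)) auto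
        finally have K: "4 * real (t ?a * 4 ^ r) \<le> \<epsilon>\<^sup>2 * real M" .
        obtain \<pi>' where \<pi>': "\<pi>' ` V \<subseteq> {..<M}" "equitable_partition V M (\<lambda>a. {v\<in>V. \<pi>' v = a})"
          "bvar V \<pi>' G \<le> bvar V \<rho> G + \<epsilon>\<^sup>2 * (real (card V))\<^sup>2"
          by (rule equitable_coarsening[OF V G01 \<rho> M K])
        have le: "bvar V \<pi>' G \<le> (real n)\<^sup>2 / 4 - real (Suc i) * \<epsilon>\<^sup>2 * (real n)\<^sup>2"
          using \<pi>'(3) less \<pi>(3) unfolding n by (simp add: algebra_simps)
        have tM: "t (1 + 12 * Suc i) = M" unfolding M_def by (rule arg_cong[where f = t]) simp
        show ?case unfolding tM by (intro exI[of _ \<pi>'] conjI \<pi>'(1,2) le)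
      qed
      \<comment> \<open>The last round that the energy admits: one further stage would make
        \<open>bvar\<close> negative.\<close>
      define i where "i = nat \<lfloor>1 / (4 * \<epsilon>\<^sup>2)\<rfloor>"
      have "real i = of_int \<lfloor>1 / (4 * \<epsilon>\<^sup>2)\<rfloor>" by (simp add: i_def)
      hence i: "real i \<le> 1 / (4 * \<epsilon>\<^sup>2)" "1 / (4 * \<epsilon>\<^sup>2) < real i + 1" by linarith+
      \<comment> \<open>If a round takes place, then
        \<open>1 / (4 * \<epsilon>\<^sup>2) \<ge> 1\<close>, and the difference between 12 and 16
        such units pays for the initial \<open>1\<close>.\<close>
      have ij: "1 + 12 * i \<le> j"
      proof (cases "i = 0")
        case False
        hence "1 \<le> real i" by simp
        hence "1 \<le> 1 / (4 * \<epsilon>\<^sup>2)" using i(1) by linarith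
        moreover have "4 / \<epsilon>\<^sup>2 = 16 * (1 / (4 * \<epsilon>\<^sup>2))" by simp
        ultimately have "1 + 12 * real i \<le> 4 / \<epsilon>\<^sup>2" using i(1) by linarith
        also have "\<dots> \<le> real j" unfolding assms(9) by linarith
        finally show ?thesis by linarith
      qed (use j1 in simp)
      from step[OF ij] obtain \<pi> where \<pi>: "\<pi> ` V \<subseteq> {..<t (1 + 12 * i)}"
          "equitable_partition V (t (1 + 12 * i)) (\<lambda>a. {v\<in>V. \<pi> v = a})"
          "bvar V \<pi> G \<le> (real n)\<^sup>2 / 4 - real i * \<epsilon>\<^sup>2 * (real n)\<^sup>2" by blast
      have "1 \<le> 1 + 12 * i" by simp
      from stage[OF this ij \<pi>(1,2)] obtain \<rho>
        where "bvar V \<rho> G < bvar V \<pi> G - 2 * \<epsilon>\<^sup>2 * (real n)\<^sup>2" by blast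
      hence "bvar V \<rho> G < (1/4 - (real i + 2) * \<epsilon>\<^sup>2) * (real n)\<^sup>2"
        using \<pi>(3) by (simp add: algebra_simps)
      also have "\<dots> \<le> 0"
      proof -
        have "1 \<le> (real i + 1) * (4 * \<epsilon>\<^sup>2)" using i(2) \<epsilon> by (simp add: divide_less_eq)
        moreover have "0 \<le> \<epsilon>\<^sup>2" by simp
        moreover have "(real i + 2) * \<epsilon>\<^sup>2 = (real i + 1) * (4 * \<epsilon>\<^sup>2) / 4 + \<epsilon>\<^sup>2"
          by (simp add: algebra_simps)
        ultimately have "1/4 - (real i + 2) * \<epsilon>\<^sup>2 \<le> 0" by linarith
        thus ?thesis by (intro mult_nonpos_nonneg) auto
      qed
      finally show False using bvar_nonneg[of V \<rho> G] by simp
    qed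
  qed
qed

end
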